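(* Let $n\ge 2$, let $\bm X=(X_1,\dots,X_n)$ be a random vector with finite alphabets $\mathcal X_1,\dots,\mathcal X_n$ and distribution $p(\bm X)$, and for each $m\ge1$ let $\mathcal S_m=\{\bm x^{(k)}\}_{k=1}^m$ be a set of $m$ i.i.d. samples from $p$. Let $\mathcal M$ be the collection of all probability distributions on $\mathcal X_1\times\dots\times\mathcal X_n$. Then $$\Omega(\bm X)=\sum_{j=2}^{n-1}\Big(\lim_{m\to\infty}\frac1m\lambda^{\mathcal M}_{\mathcal K^j_{\mathrm H}}(\mathcal S_m)-\lim_{m\to\infty}\frac1m\lambda^{\mathcal M}_{\mathcal K^j_{\mathrm T}}(\mathcal S_m)\Big)=\sum_{j=2}^{n-1}\Big(\inf_{q\in\mathcal K^j_{\mathrm H}}D(p\,\|\,q)-\inf_{q'\in\mathcal K^j_{\mathrm T}}D(p\,\|\,q')\Big),$$ where the limits are limits in probability and empty sums are zero.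
   Context: $H$ denotes Shannon entropy and $D(p\,\|\,q)$ the Kullback–Leibler divergence. All logarithms have the same base. Notation: $\bm X_i^j=(X_i,\dots,X_j)$, $\bm X^j=\bm X_1^j$, and $\bm X_{-j}$ is $\bm X$ with $X_j$ deleted. The O-information is $$\Omega(\bm X)=(n-2)H(\bm X)+\sum_{j=1}^n\big(H(X_j)-H(\bm X_{-j})\big).$$ For $2\le j\le n-1$, define the following classes of probability distributions on $\mathcal X_1\times\dots\times\mathcal X_n$: $$\mathcal K_{\mathrm T}^j=\{q: q(\bm X)=q(X_j)\,q(\bm X^{j-1}\mid X_j)\,q(\bm X_{j+1}^n\mid X_j)\},$$ $$\mathcal K_{\mathrm H}^j=\{q: q(\bm X)=q(X_j\mid\bm X_{-j})\,q(\bm X^{j-1})\,q(\bm X_{j+1}^n)\}.$$ That is, under $q\in\mathcal K_{\mathrm T}^j$ the vectors $\bm X^{j-1}$ and $\bm X_{j+1}^n$ are conditionally independent given $X_j$, and under $q\in\mathcal K_{\mathrm H}^j$ they are independent. The likelihood of a distribution $q$ on the sample is $\Lambda(\mathcal S_m;q)=\prod_{k=1}^m q(\bm x^{(k)})$, and the generalized likelihood ratio between classes $\mathcal C,\mathcal C'$ is $$\lambda_{\mathcal C'}^{\mathcal C}(\mathcal S_m)=\log\frac{\sup_{r\in\mathcal C}\Lambda(\mathcal S_m;r)}{\sup_{s\in\mathcal C'}\Lambda(\mathcal S_m;s)}.$$ *)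

theory Defs
  imports "HOL-Probability.Probability"
begin

definition (in information_space) O_information :: "nat \<Rightarrow> (nat \<Rightarrow> 'a \<Rightarrow> 'c) \<Rightarrow> real" where
  "O_information n X =
     (real n - 2) * \<H>(\<lambda>\<omega>. \<lambda>i\<in>{1..n}. X i \<omega>) +
     (\<Sum>j=1..n. \<H>(X j) - \<H>(\<lambda>\<omega>. \<lambda>i\<in>{1..n} - {j}. X i \<omega>))"

definition product_space :: "nat \<Rightarrow> (nat \<Rightarrow> 'c set) \<Rightarrow> (nat \<Rightarrow> 'c) set" where
  "product_space n A = (\<Pi>\<^sub>E i\<in>{1..n}. A i)"

definition all_dists :: "nat \<Rightarrow> (nat \<Rightarrow> 'c set) \<Rightarrow> (nat \<Rightarrow> 'c) pmf set" where
  "all_dists n A = {q. set_pmf q \<subseteq> product_space n A}"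

definition marginal :: "(nat \<Rightarrow> 'c) pmf \<Rightarrow> nat set \<Rightarrow> (nat \<Rightarrow> 'c) \<Rightarrow> real" where
  "marginal q I x = pmf (map_pmf (\<lambda>y. restrict y I) q) (restrict x I)"

(* q(x_I | x_J); a conditional probability given a null event is 0, since x / 0 = 0. *)
definition conditional :: "(nat \<Rightarrow> 'c) pmf \<Rightarrow> nat set \<Rightarrow> nat set \<Rightarrow> (nat \<Rightarrow> 'c) \<Rightarrow> real" where
  "conditional q I J x = marginal q (I \<union> J) x / marginal q J x"

definition K_T :: "nat \<Rightarrow> (nat \<Rightarrow> 'c set) \<Rightarrow> nat \<Rightarrow> (nat \<Rightarrow> 'c) pmf set" where
  "K_T n A j = {q \<in> all_dists n A. \<forall>x\<in>product_space n A.
     pmf q x = marginal q {j} x * conditional q {1..j - 1} {j} x * conditional q {j + 1..n} {j} x}"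

(* The convention for null events is harmless here: the factorisation on the support of
   x_{-j} already forces the product of the two marginals to carry its whole mass on that
   support, so that the two blocks are independent. *)
definition K_H :: "nat \<Rightarrow> (nat \<Rightarrow> 'c set) \<Rightarrow> nat \<Rightarrow> (nat \<Rightarrow> 'c) pmf set" where
  "K_H n A j = {q \<in> all_dists n A. \<forall>x\<in>product_space n A.
     pmf q x = conditional q {j} ({1..n} - {j}) x * marginal q {1..j - 1} x * marginal q {j + 1..n} x}"

(* KL_divergence is real-valued and has an unspecified or meaningless value when p is not
   absolutely continuous with respect to q; there the divergence is infinite. *)
definition divergence :: "real \<Rightarrow> 'x pmf \<Rightarrow> 'x pmf \<Rightarrow> ereal" where
  "divergence b p q =
     (if absolutely_continuous (measure_pmf q) (measure_pmf p)
      then ereal (KL_divergence b (measure_pmf q) (measure_pmf p)) else \<infinity>)"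

definition likelihood :: "nat \<Rightarrow> (nat \<Rightarrow> 'x) \<Rightarrow> 'x pmf \<Rightarrow> real" where
  "likelihood m s q = (\<Prod>k=1..m. pmf q (s k))"

(* Likelihoods lie in [0, 1], so the real suprema are genuine for nonempty classes. *)
definition gen_likelihood_ratio ::
    "real \<Rightarrow> 'x pmf set \<Rightarrow> 'x pmf set \<Rightarrow> nat \<Rightarrow> (nat \<Rightarrow> 'x) \<Rightarrow> real" where
  "gen_likelihood_ratio b C C' m s =
     log b ((SUP r\<in>C. likelihood m s r) / (SUP r\<in>C'. likelihood m s r))"

definition tendsto_in_prob :: "'w measure \<Rightarrow> (nat \<Rightarrow> 'w \<Rightarrow> real) \<Rightarrow> real \<Rightarrow> bool" where
  "tendsto_in_prob M Y c \<longleftrightarrow> (\<forall>m. Y m \<in> borel_measurable M) \<and>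
     (\<forall>\<epsilon>>0. (\<lambda>m. measure M {\<omega> \<in> space M. \<bar>Y m \<omega> - c\<bar> > \<epsilon>}) \<longlonglongrightarrow> 0)"

end

theory Submission
  imports Defs "HOL-Real_Asymp.Real_Asymp"
begin

text \<open>
  Write \<open>L\<close> and \<open>R\<close> for the blocks left and right of \<open>j\<close>. The elements of both classes factor into
  conditional marginals, so the conditional Gibbs inequality, applied factor by factor, shows that
  \<open>\<Sum>x. P x log (q x)\<close> is maximal over a class at the \<open>q\<close> whose factors are those of \<open>P\<close>. For
  \<open>P = p\<close> this gives the two infima as the mutual information of \<open>L\<close> and \<open>R\<close>, unconditionally and
  given \<open>X\<^sub>j\<close>. For \<open>P\<close> the empirical distribution it gives the normalised log likelihood ratios
  as the same functionals of \<open>P\<close>; these are continuous and the empirical distribution tends to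
  \<open>p\<close> in probability by Hoeffding's inequality. Expanding the mutual informations into entropies
  makes the sum over \<open>j\<close> telescope to the O-information.
\<close>

section \<open>Marginals of weights on a finite product\<close>

locale finite_product =
  fixes n :: nat and A :: "nat \<Rightarrow> 'c set"
  assumes finite_A: "\<And>i. i \<in> {1..n} \<Longrightarrow> finite (A i)"
begin

abbreviation \<Omega> :: "(nat \<Rightarrow> 'c) set" where
  "\<Omega> \<equiv> product_space n A"

text \<open>A marginal keeps a full point as its argument, so that marginals over different index
  sets can be multiplied and summed over the one space \<Omega>. It is defined for arbitrary weights
  because marginals are themselves marginalised, as in \<open>slice\<close>.\<close>

definition marg :: "((nat \<Rightarrow> 'c) \<Rightarrow> real) \<Rightarrow> nat set \<Rightarrow> (nat \<Rightarrow> 'c) \<Rightarrow> real" where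
  "marg u I x = (\<Sum>y\<in>{y \<in> \<Omega>. restrict y I = restrict x I}. u y)"

lemma finite_space [simp]: "finite \<Omega>"
  unfolding product_space_def by (intro finite_PiE) (auto simp: finite_A)

lemma restrict_eq_iff: "restrict x I = restrict y I \<longleftrightarrow> (\<forall>i\<in>I. x i = y i)"
  by (metis restrict_apply' restrict_ext)

lemma restrict_eq_mono: "restrict x I = restrict y I \<Longrightarrow> J \<subseteq> I \<Longrightarrow> restrict x J = restrict y J"
  by (auto simp: restrict_eq_iff)

lemma space_eqI:
  assumes "x \<in> \<Omega>" "y \<in> \<Omega>" "restrict x {1..n} = restrict y {1..n}"
  shows "x = y"
  using assms unfolding product_space_def by (metis PiE_restrict)

lemma marg_cong: "restrict x I = restrict y I \<Longrightarrow> marg u I x = marg u I y"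
  by (simp add: marg_def)

lemma marg_cong_weight: "(\<And>y. y \<in> \<Omega> \<Longrightarrow> u y = v y) \<Longrightarrow> marg u I x = marg v I x"
  unfolding marg_def by (intro sum.cong) auto

lemma marg_alt: "marg u I x = (\<Sum>y\<in>\<Omega>. if restrict y I = restrict x I then u y else 0)"
  unfolding marg_def by (subst sum.inter_filter) auto

lemma marg_empty [simp]: "marg u {} x = sum u \<Omega>"
  by (simp add: marg_def restrict_def)

lemma marg_full: "x \<in> \<Omega> \<Longrightarrow> marg u {1..n} x = u x"
proof -
  assume x: "x \<in> \<Omega>"
  then have "{y \<in> \<Omega>. restrict y {1..n} = restrict x {1..n}} = {x}"
    using space_eqI by blast
  then show ?thesis by (simp add: marg_def)
qed

lemma marg_nonneg: "(\<And>y. y \<in> \<Omega> \<Longrightarrow> 0 \<le> u y) \<Longrightarrow> 0 \<le> marg u I x"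
  unfolding marg_def by (intro sum_nonneg) auto

lemma marg_ge:
  assumes "\<And>y. y \<in> \<Omega> \<Longrightarrow> 0 \<le> u y" "x \<in> \<Omega>"
  shows "u x \<le> marg u I x"
  unfolding marg_def using assms by (intro member_le_sum) auto

lemma marg_mono:
  assumes "\<And>y. y \<in> \<Omega> \<Longrightarrow> 0 \<le> u y" "J \<subseteq> I"
  shows "marg u I x \<le> marg u J x"
  unfolding marg_def
proof (rule sum_mono2)
  show "{y \<in> \<Omega>. restrict y I = restrict x I} \<subseteq> {y \<in> \<Omega>. restrict y J = restrict x J}"
    using restrict_eq_mono[OF _ assms(2)] by blast
qed (use assms(1) in auto)

lemma marg_cmult:
  assumes "x \<in> \<Omega>" "\<And>y. y \<in> \<Omega> \<Longrightarrow> restrict y I = restrict x I \<Longrightarrow> c y = c x"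
  shows "marg (\<lambda>y. c y * u y) I x = c x * marg u I x"
  unfolding marg_def sum_distrib_left by (intro sum.cong refl) (metis (lifting) assms(2) mem_Collect_eq)

text \<open>Each fibre of restriction to \<open>J\<close> is a disjoint union of fibres of
  restriction to the larger set \<open>I\<close>, and on each of these the two weights have equal
  sums.\<close>

lemma tower:
  assumes "\<And>x. x \<in> \<Omega> \<Longrightarrow> marg u I x = marg v I x" "J \<subseteq> I"
  shows "marg u J x = marg v J x"
proof -
  let ?S = "{y \<in> \<Omega>. restrict y J = restrict x J}"
  let ?\<rho> = "\<lambda>y. restrict y I"
  have "sum w ?S = (\<Sum>z\<in>?\<rho> ` ?S. sum w {y \<in> ?S. ?\<rho> y = z})" for w :: "(nat \<Rightarrow> 'c) \<Rightarrow> real"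
    by (intro sum.image_gen) auto
  moreover have "sum u {y \<in> ?S. ?\<rho> y = z} = sum v {y \<in> ?S. ?\<rho> y = z}" if "z \<in> ?\<rho> ` ?S" for z
  proof -
    from that obtain x' where x': "x' \<in> ?S" "z = ?\<rho> x'" by blast
    \<comment> \<open>As \<open>J\<close> is contained in \<open>I\<close>, every point of \<Omega>
      that agrees with \<open>x'\<close> on \<open>I\<close> lies in \<open>?S\<close>; so this is a
      whole \<open>I\<close>-fibre.\<close>
    have "{y \<in> ?S. ?\<rho> y = z} = {y \<in> \<Omega>. restrict y I = restrict x' I}"
      using x' restrict_eq_mono[OF _ assms(2), of _ x'] by (intro Collect_cong) (metis (lifting) mem_Collect_eq)
    then show ?thesis using assms(1)[of x'] x' by (simp add: marg_def)
  qed
  ultimately show ?thesis unfolding marg_def by simp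
qed

text \<open>Two points of the space that agree on \<open>I \<inter> J\<close> have exactly one common extension of
  the \<open>I\<close>-part of the first and the \<open>J\<close>-part of the second.\<close>

lemma slice:
  assumes x: "x \<in> \<Omega>" and IJ: "I \<union> J = {1..n}"
  shows "marg (marg u J) I x = marg u (I \<inter> J) x"
proof -
  have card: "(\<Sum>z\<in>\<Omega>. if restrict z I = restrict x I \<and> restrict y J = restrict z J then u y else 0) =
        (if restrict y (I \<inter> J) = restrict x (I \<inter> J) then u y else 0)" (is "?s = _")
    if y: "y \<in> \<Omega>" for y
  proof (cases "restrict y (I \<inter> J) = restrict x (I \<inter> J)")
    case True
    define z where "z = (\<lambda>i. if i \<in> I then x i else y i)"
    have z: "z \<in> \<Omega>" "restrict z I = restrict x I" "restrict y J = restrict z J"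
      using x y True IJ by (auto simp: z_def product_space_def PiE_iff extensional_def restrict_eq_iff)
    have "z' = z" if "z' \<in> \<Omega>" "restrict z' I = restrict x I" "restrict y J = restrict z' J" for z'
      
      by (rule space_eqI) (use z that in \<open>unfold IJ[symmetric] restrict_eq_iff, auto\<close>)
    then have "{z' \<in> \<Omega>. restrict z' I = restrict x I \<and> restrict y J = restrict z' J} = {z}"
      using z by blast
    then show ?thesis using True by (simp add: sum.inter_filter[symmetric])
  next
    case False
    then have "(restrict z I = restrict x I \<and> restrict y J = restrict z J) \<longleftrightarrow> False" for z
      by (auto simp: restrict_eq_iff)
    then show ?thesis using False by (simp only: if_False sum.neutral_const)
  qed
  have "marg (marg u J) I x =
      (\<Sum>z\<in>\<Omega>. \<Sum>y\<in>\<Omega>. if restrict z I = restrict x I \<and> restrict y J = restrict z J then u y else 0)"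
    unfolding marg_alt by (intro sum.cong) auto
  also have "\<dots> = marg u (I \<inter> J) x"
    by (subst sum.swap) (simp add: card marg_alt cong: sum.cong)
  finally show ?thesis .
qed

section \<open>Gibbs' inequality for conditional weights\<close>

text \<open>Expanding \<open>marg v I x\<close> and swapping the sums collects \<open>u\<close> over
  the \<open>I\<close>-fibre of \<open>y\<close> into \<open>marg u I y\<close>, which cancels the
  denominator. For this \<open>c\<close> has to be constant on \<open>I\<close>-fibres.\<close>

lemma sum_marg_exchange:
  fixes u v c :: "(nat \<Rightarrow> 'c) \<Rightarrow> real"
  assumes "\<And>x. x \<in> \<Omega> \<Longrightarrow> 0 \<le> u x" "\<And>x. x \<in> \<Omega> \<Longrightarrow> 0 \<le> v x" "\<And>x. x \<in> \<Omega> \<Longrightarrow> 0 \<le> c x"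
    and c: "\<And>x y. restrict x I = restrict y I \<Longrightarrow> c x = c y"
  shows "(\<Sum>x\<in>\<Omega>. u x * (marg v I x * c x / marg u I x)) \<le> (\<Sum>x\<in>\<Omega>. v x * c x)"
proof -
  have "(\<Sum>x\<in>\<Omega>. u x * (marg v I x * c x / marg u I x)) =
      (\<Sum>x\<in>\<Omega>. \<Sum>y\<in>\<Omega>. if restrict y I = restrict x I then u x * (v y * c x / marg u I x) else 0)"
    unfolding marg_alt[of v] sum_distrib_left sum_distrib_right sum_divide_distrib
    by (intro sum.cong refl) auto
  also have "\<dots> = (\<Sum>y\<in>\<Omega>. \<Sum>x\<in>\<Omega>. (v y * c y / marg u I y) * (if restrict x I = restrict y I then u x else 0))"
  proof (subst sum.swap, intro sum.cong refl)
    fix x y assume "x \<in> \<Omega>" "y \<in> \<Omega>"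
    show "(if restrict y I = restrict x I then u x * (v y * c x / marg u I x) else 0) =
        v y * c y / marg u I y * (if restrict x I = restrict y I then u x else 0)"
    proof (cases "restrict x I = restrict y I")
      case True
      then show ?thesis using c[OF True] marg_cong[OF True, of u] by simp
    next
      case False
      then show ?thesis by (simp add: eq_commute)
    qed
  qed
  also have "\<dots> = (\<Sum>y\<in>\<Omega>. v y * c y / marg u I y * marg u I y)"
    unfolding marg_alt[of u] sum_distrib_left ..
  \<comment> \<open>Equality holds termwise where \<open>marg u I\<close> is nonzero; elsewhere
    division by zero makes the left term 0, and the right one is nonnegative.\<close>
  also have "\<dots> \<le> (\<Sum>x\<in>\<Omega>. v x * c x)"
    by (intro sum_mono) (use assms(1-3) in auto)
  finally show ?thesis .
qed

text \<open>As in the classical Gibbs inequality, \<open>ln t \<le> t - 1\<close> is applied to the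
  ratio \<open>t\<close> of the two conditional weights. It remains to see that the
  \<open>u\<close>-weighted sum of \<open>t\<close> is at most the total mass of \<open>u\<close>,
  which takes two applications of \<open>sum_marg_exchange\<close>.\<close>

lemma conditional_Gibbs:
  assumes "1 < b" "J \<subseteq> I"
    and u: "\<And>x. x \<in> \<Omega> \<Longrightarrow> 0 \<le> u x" and v: "\<And>x. x \<in> \<Omega> \<Longrightarrow> 0 \<le> v x"
    and ac: "\<And>x. x \<in> \<Omega> \<Longrightarrow> u x > 0 \<Longrightarrow> v x > 0"
  shows "(\<Sum>x\<in>\<Omega>. u x * log b (marg v I x / marg v J x)) \<le>
         (\<Sum>x\<in>\<Omega>. u x * log b (marg u I x / marg u J x))"
proof -
  have nn: "marg u K x \<ge> 0" "marg v K x \<ge> 0" for K x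
    using u v by (auto intro: marg_nonneg)
  \<comment> \<open>The conditional weight of \<open>v\<close> divided by that of \<open>u\<close>,
    arranged to match \<open>sum_marg_exchange\<close>.\<close>
  define t where "t x = marg v I x * (marg u J x / marg v J x) / marg u I x" for x
  have pointwise: "u x * log b (marg v I x / marg v J x) - u x * log b (marg u I x / marg u J x)
      \<le> (u x * t x - u x) / ln b" if x: "x \<in> \<Omega>" for x
  proof (cases "u x = 0")
    case False
    then have "u x > 0" using u[OF x] by simp
    with ac x have "v x > 0" by simp
    then have pos: "marg u I x > 0" "marg u J x > 0" "marg v I x > 0" "marg v J x > 0"
      using \<open>u x > 0\<close> marg_ge[of u x, OF u x] marg_ge[of v x, OF v x] by (meson less_le_trans)+
    then have "log b (marg v I x / marg v J x) - log b (marg u I x / marg u J x) = ln (t x) / ln b"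
      by (simp add: t_def log_def ln_div ln_mult diff_divide_distrib[symmetric])
    also have "\<dots> \<le> (t x - 1) / ln b"
      using pos \<open>1 < b\<close> by (intro divide_right_mono ln_le_minus_one) (auto simp: t_def)
    finally have "u x * (log b (marg v I x / marg v J x) - log b (marg u I x / marg u J x))
       \<le> u x * ((t x - 1) / ln b)" using u[OF x] by (rule mult_left_mono)
    then show ?thesis by (simp add: right_diff_distrib)
  qed simp
  \<comment> \<open>The first exchange is over \<open>I\<close>, with the quotient of the
    \<open>J\<close>-marginals as \<open>c\<close>.\<close>
  have "(\<Sum>x\<in>\<Omega>. u x * t x) \<le> (\<Sum>x\<in>\<Omega>. v x * (marg u J x / marg v J x))"
    unfolding t_def
  proof (intro sum_marg_exchange divide_nonneg_nonneg u v nn)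
    fix x y :: "nat \<Rightarrow> 'c" assume "restrict x I = restrict y I"
    then have "restrict x J = restrict y J" using \<open>J \<subseteq> I\<close> by (rule restrict_eq_mono)
    then show "marg u J x / marg v J x = marg u J y / marg v J y"
      using marg_cong by metis
  qed
  \<comment> \<open>The second exchange is over \<open>J\<close>, with \<open>u\<close> and
    \<open>v\<close> interchanged and \<open>c = 1\<close>; the factor 1 is written out to
    match.\<close>
  also have "\<dots> = (\<Sum>x\<in>\<Omega>. v x * (marg u J x * 1 / marg v J x))" by simp
  also have "\<dots> \<le> (\<Sum>x\<in>\<Omega>. u x * 1)"
    using assms by (intro sum_marg_exchange) auto
  finally have "((\<Sum>x\<in>\<Omega>. u x * t x) - (\<Sum>x\<in>\<Omega>. u x)) / ln b \<le> 0"
    using \<open>1 < b\<close> by (simp add: divide_nonpos_pos)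
  moreover have "(\<Sum>x\<in>\<Omega>. u x * log b (marg v I x / marg v J x)) -
      (\<Sum>x\<in>\<Omega>. u x * log b (marg u I x / marg u J x)) \<le> ((\<Sum>x\<in>\<Omega>. u x * t x) - (\<Sum>x\<in>\<Omega>. u x)) / ln b"
    unfolding sum_subtractf[symmetric] sum_divide_distrib by (intro sum_mono pointwise)
  ultimately show ?thesis by linarith
qed

section \<open>Passing between distributions and weights\<close>

lemma marginal_eq_marg:
  assumes "q \<in> all_dists n A"
  shows "marginal q I x = marg (pmf q) I x"
proof -
  have "marginal q I x = measure (measure_pmf q) {y. restrict y I = restrict x I}"
    by (simp add: marginal_def pmf_map vimage_def)
  also have "\<dots> = measure (measure_pmf q) {y \<in> \<Omega>. restrict y I = restrict x I}"
    using assms by (intro measure_pmf.finite_measure_eq_AE) (auto simp: AE_measure_pmf_iff all_dists_def)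
  also have "\<dots> = marg (pmf q) I x"
    unfolding marg_def by (rule measure_measure_pmf_finite) simp
  finally show ?thesis .
qed

lemma sum_pmf: "q \<in> all_dists n A \<Longrightarrow> sum (pmf q) \<Omega> = 1"
  by (intro sum_pmf_eq_1) (auto simp: all_dists_def)

lemma weight_pmf:
  assumes "\<And>x. x \<in> \<Omega> \<Longrightarrow> 0 \<le> f x" "sum f \<Omega> = 1"
  obtains q where "q \<in> all_dists n A" "\<And>x. x \<in> \<Omega> \<Longrightarrow> pmf q x = f x"
proof -
  \<comment> \<open>\<open>embed_pmf\<close> needs total mass 1 over all functions and not only over
    \<Omega>, hence the cut-off.\<close>
  define g where "g x = (if x \<in> \<Omega> then f x else 0)" for x
  have g: "0 \<le> g x" for x using assms(1) by (simp add: g_def)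
  have "(\<integral>\<^sup>+ x. ennreal (g x) \<partial>count_space UNIV) = (\<Sum>x\<in>\<Omega>. ennreal (g x))"
    by (intro nn_integral_count_space') (auto simp: g_def)
  also have "\<dots> = 1"
    using g assms(2) by (subst sum_ennreal) (use assms in \<open>auto simp: g_def cong: sum.cong\<close>)
  finally have pmf: "pmf (embed_pmf g) x = g x" for x
    using g by (intro pmf_embed_pmf) auto
  then have "set_pmf (embed_pmf g) \<subseteq> \<Omega>"
    by (auto simp: set_pmf_eq g_def split: if_splits)
  with pmf that[of "embed_pmf g"] show thesis by (auto simp: all_dists_def g_def)
qed

section \<open>Projections onto the two classes\<close>

text \<open>For the weights of a pmf this is the Shannon entropy of the coordinates in
  \<open>I\<close>: each value of the marginal occurs once per point of its fibre, weighted by that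
  point.\<close>

definition ent :: "real \<Rightarrow> ((nat \<Rightarrow> 'c) \<Rightarrow> real) \<Rightarrow> nat set \<Rightarrow> real" where
  "ent b u I = - (\<Sum>x\<in>\<Omega>. u x * log b (marg u I x))"

text \<open>For \<open>P = p\<close> this is absolute continuity, for an empirical \<open>P\<close>
  positivity of the likelihood. Where it fails, the true value of \<open>mean_log b P q\<close> is
  minus infinity, which the real-valued sum does not express.\<close>

definition dominates :: "(nat \<Rightarrow> 'c) pmf \<Rightarrow> (nat \<Rightarrow> 'c) pmf \<Rightarrow> bool" where
  "dominates q P \<longleftrightarrow> (\<forall>x\<in>\<Omega>. 0 < pmf P x \<longrightarrow> 0 < pmf q x)"

text \<open>The negative cross entropy of \<open>P\<close> and \<open>q\<close>.\<close>

definition mean_log :: "real \<Rightarrow> (nat \<Rightarrow> 'c) pmf \<Rightarrow> (nat \<Rightarrow> 'c) pmf \<Rightarrow> real" where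
  "mean_log b P q = (\<Sum>x\<in>\<Omega>. pmf P x * log b (pmf q x))"

text \<open>The maximiser of \<open>mean_log b P\<close> is at once the divergence minimiser over \<open>C\<close> and, when
  \<open>P\<close> is the empirical distribution of a sample, the maximum likelihood estimate in \<open>C\<close>.\<close>

definition projection_gap :: "real \<Rightarrow> (nat \<Rightarrow> 'c) pmf \<Rightarrow> (nat \<Rightarrow> 'c) pmf set \<Rightarrow> real \<Rightarrow> bool" where
  "projection_gap b P C d \<longleftrightarrow> (\<exists>Q\<in>C. dominates Q P \<and>
     (\<forall>q\<in>C. dominates q P \<longrightarrow> mean_log b P q \<le> mean_log b P Q) \<and> mean_log b P P - mean_log b P Q = d)"

lemma marg_pmf_nonneg: "0 \<le> marg (pmf q) I x"
  by (intro marg_nonneg) auto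

lemma marg_pmf_pos: "x \<in> \<Omega> \<Longrightarrow> 0 < pmf q x \<Longrightarrow> 0 < marg (pmf q) I x"
  using marg_ge[of "pmf q" x I] by (meson less_le_trans pmf_nonneg)

lemma mean_log_self: "mean_log b P P = - ent b (pmf P) {1..n}"
  by (simp add: mean_log_def ent_def marg_full[simplified] cong: sum.cong)

lemma mean_log_marg_ratio:
  "(\<Sum>x\<in>\<Omega>. pmf P x * log b (marg (pmf P) I x / marg (pmf P) J x)) = ent b (pmf P) J - ent b (pmf P) I"
proof -
  have "pmf P x * log b (marg (pmf P) I x / marg (pmf P) J x) =
      pmf P x * log b (marg (pmf P) I x) - pmf P x * log b (marg (pmf P) J x)" if "x \<in> \<Omega>" for x
  proof (cases "pmf P x = 0")
    case False
    then have "0 < pmf P x" using pmf_nonneg[of P x] by linarith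
    then show ?thesis using that by (simp add: log_divide_pos marg_pmf_pos right_diff_distrib)
  qed simp
  then show ?thesis by (simp add: ent_def sum_subtractf cong: sum.cong)
qed

lemma ent_empty: "P \<in> all_dists n A \<Longrightarrow> ent b (pmf P) {} = 0"
  by (simp add: ent_def sum_pmf)

text \<open>Both classes consist of products of three conditional marginals, so
  \<open>mean_log\<close> splits into three sums, and \<open>conditional_Gibbs\<close> bounds each
  by its value for the factors of \<open>P\<close>. \<open>Q\<close> attains all three bounds at
  once. Its factors are prescribed only on the support of \<open>P\<close>, the only place that
  \<open>mean_log\<close> sees.\<close>

lemma projection_gapI:
  fixes I J :: "nat \<Rightarrow> nat set"
  assumes "1 < b" and J: "\<And>i. i < 3 \<Longrightarrow> J i \<subseteq> I i"
    and q: "\<And>q x. q \<in> C \<Longrightarrow> x \<in> \<Omega> \<Longrightarrow> pmf q x = (\<Prod>i<3. marg (pmf q) (I i) x / marg (pmf q) (J i) x)"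
    and Q: "Q \<in> C" "\<And>x. x \<in> \<Omega> \<Longrightarrow> 0 < pmf P x \<Longrightarrow>
              pmf Q x = (\<Prod>i<3. marg (pmf P) (I i) x / marg (pmf P) (J i) x)"
    and d: "d = (\<Sum>i<3. ent b (pmf P) (I i) - ent b (pmf P) (J i)) - ent b (pmf P) {1..n}"
  shows "projection_gap b P C d"
proof -
  have pos_prod: "0 < (\<Prod>i<3. marg (pmf r) (I i) x / marg (pmf r) (J i) x)"
    if "x \<in> \<Omega>" "0 < pmf r x" for r x
    using that by (auto intro!: prod_pos simp: marg_pmf_pos)
  \<comment> \<open>Applied with \<open>r = P\<close> to the maximiser \<open>Q\<close>, and with
    \<open>r = q\<close> to a competitor \<open>q\<close>. The logarithm of the product splits
    because the marginals of \<open>r\<close> are positive wherever \<open>P\<close> is.\<close>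
  have split: "mean_log b P q = (\<Sum>i<3. \<Sum>x\<in>\<Omega>. pmf P x * log b (marg (pmf r) (I i) x / marg (pmf r) (J i) x))"
    if "\<And>x. x \<in> \<Omega> \<Longrightarrow> 0 < pmf P x \<Longrightarrow> 0 < pmf r x"
      "\<And>x. x \<in> \<Omega> \<Longrightarrow> 0 < pmf P x \<Longrightarrow> pmf q x = (\<Prod>i<3. marg (pmf r) (I i) x / marg (pmf r) (J i) x)" for q r
  proof -
    have "pmf P x * log b (pmf q x) = (\<Sum>i<3. pmf P x * log b (marg (pmf r) (I i) x / marg (pmf r) (J i) x))"
      if x: "x \<in> \<Omega>" for x
    proof (cases "pmf P x = 0")
      case False
      then have "0 < pmf P x" using pmf_nonneg[of P x] by linarith
      with that x have "pmf q x = (\<Prod>i<3. marg (pmf r) (I i) x / marg (pmf r) (J i) x)" "0 < pmf r x"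
        using \<open>\<And>x. x \<in> \<Omega> \<Longrightarrow> 0 < pmf P x \<Longrightarrow> 0 < pmf r x\<close>
          \<open>\<And>x. x \<in> \<Omega> \<Longrightarrow> 0 < pmf P x \<Longrightarrow> pmf q x = _ x\<close> by auto
      then show ?thesis
        using x marg_pmf_pos[of x r]
        by (simp add: log_def ln_prod sum_distrib_left sum_divide_distrib less_imp_neq[symmetric])
    qed simp
    then show ?thesis
      unfolding mean_log_def by (subst sum.swap) (auto intro: sum.cong)
  qed
  have Qval: "mean_log b P Q =
      (\<Sum>i<3. \<Sum>x\<in>\<Omega>. pmf P x * log b (marg (pmf P) (I i) x / marg (pmf P) (J i) x))"
    using Q(2) by (intro split)
  have "dominates Q P"
    using Q(2) pos_prod[of _ P] by (auto simp: dominates_def)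
  moreover have "mean_log b P q \<le> mean_log b P Q" if "q \<in> C" "dominates q P" for q
  proof -
    have "mean_log b P q =
      (\<Sum>i<3. \<Sum>x\<in>\<Omega>. pmf P x * log b (marg (pmf q) (I i) x / marg (pmf q) (J i) x))"
      using that q by (intro split) (auto simp: dominates_def)
    also have "\<dots> \<le> mean_log b P Q"
      unfolding Qval using that J \<open>1 < b\<close>
      by (intro sum_mono conditional_Gibbs) (auto simp: dominates_def)
    finally show ?thesis .
  qed
  moreover have "mean_log b P P - mean_log b P Q = d"
    unfolding Qval mean_log_marg_ratio mean_log_self d sum_subtractf by simp
  ultimately show ?thesis using Q(1) unfolding projection_gap_def by blast
qed

text \<open>\<open>P\<close> is its own projection. The full marginal is the only proper factor; the
  other two are the total mass over itself, that is 1.\<close>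

lemma projection_gap_all_dists:
  assumes "1 < b" "P \<in> all_dists n A"
  shows "projection_gap b P (all_dists n A) 0"
proof (rule projection_gapI[where Q = P and I = "\<lambda>i. if i = 0 then {1..n} else {}" and J = "\<lambda>_. {}"])
qed (use assms in \<open>auto simp: eval_nat_numeral ent_empty sum_pmf marg_full[simplified]\<close>)

text \<open>This \<open>Q\<close> is the projection onto the class of conditional independence.
  Summing out one block by \<open>slice\<close> turns its marginal with \<open>J\<close> into the
  marginal over \<open>J\<close>, which cancels the denominator; the remaining marginals and the
  total mass follow by \<open>tower\<close>.\<close>

lemma markov_coupling:
  assumes P: "P \<in> all_dists n A" and part: "L \<union> J \<union> R = {1..n}" "L \<inter> R = {}"
  obtains Q where "Q \<in> all_dists n A"
    "\<And>x. x \<in> \<Omega> \<Longrightarrow> pmf Q x = marg (pmf P) (L \<union> J) x * marg (pmf P) (R \<union> J) x / marg (pmf P) J x"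
    "\<And>x. x \<in> \<Omega> \<Longrightarrow> marg (pmf Q) (L \<union> J) x = marg (pmf P) (L \<union> J) x"
    "\<And>x. x \<in> \<Omega> \<Longrightarrow> marg (pmf Q) (R \<union> J) x = marg (pmf P) (R \<union> J) x"
    "\<And>x. x \<in> \<Omega> \<Longrightarrow> marg (pmf Q) J x = marg (pmf P) J x"
proof -
  \<comment> \<open>Stated for \<open>K\<close> and \<open>K'\<close> to serve both blocks by
    symmetry.\<close>
  have half: "marg (\<lambda>x. marg (pmf P) (K \<union> J) x * marg (pmf P) (K' \<union> J) x / marg (pmf P) J x) (K \<union> J) x =
      marg (pmf P) (K \<union> J) x"
    if x: "x \<in> \<Omega>" and K: "K \<union> J \<union> K' = {1..n}" "K \<inter> K' = {}" for x K K'
  proof -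
    have inv: "marg (pmf P) (K \<union> J) y / marg (pmf P) J y = marg (pmf P) (K \<union> J) x / marg (pmf P) J x"
      if "restrict y (K \<union> J) = restrict x (K \<union> J)" for y
      using that marg_cong[of y "K \<union> J" x] marg_cong[of y J x] restrict_eq_mono[of y "K \<union> J" x J] by auto
    have "marg (\<lambda>x. (marg (pmf P) (K \<union> J) x / marg (pmf P) J x) * marg (pmf P) (K' \<union> J) x) (K \<union> J) x =
        marg (pmf P) (K \<union> J) x / marg (pmf P) J x * marg (marg (pmf P) (K' \<union> J)) (K \<union> J) x"
      using x inv by (intro marg_cmult)
    also have "marg (marg (pmf P) (K' \<union> J)) (K \<union> J) x = marg (pmf P) ((K \<union> J) \<inter> (K' \<union> J)) x"
      using x K by (intro slice) auto
    also have "(K \<union> J) \<inter> (K' \<union> J) = J" using K by auto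
    \<comment> \<open>Where the \<open>J\<close>-marginal vanishes, so does the finer marginal, and
      the equation reads 0 = 0.\<close>
    finally show ?thesis
      using marg_mono[of "pmf P" J "K \<union> J" x] marg_pmf_nonneg[of P "K \<union> J" x]
      by (cases "marg (pmf P) J x = 0") auto
  qed
  define f where "f x = marg (pmf P) (L \<union> J) x * marg (pmf P) (R \<union> J) x / marg (pmf P) J x" for x
  have LJ: "marg f (L \<union> J) x = marg (pmf P) (L \<union> J) x" if "x \<in> \<Omega>" for x
    unfolding f_def using half[of x L R] that part by auto
  have RJ: "marg f (R \<union> J) x = marg (pmf P) (R \<union> J) x" if "x \<in> \<Omega>" for x
    unfolding f_def using half[of x R L] that part by (auto simp: ac_simps)
  have J: "marg f J x = marg (pmf P) J x" for x
    by (rule tower[OF LJ]) auto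
  \<comment> \<open>The marginal over the empty set is the total mass, at whatever point it is
    taken.\<close>
  have "marg f {} undefined = marg (pmf P) {} undefined"
    by (rule tower[OF LJ]) auto
  then have "sum f \<Omega> = 1" using sum_pmf[OF P] by simp
  moreover have "0 \<le> f x" for x by (simp add: f_def marg_pmf_nonneg)
  ultimately obtain Q where Q: "Q \<in> all_dists n A" "\<And>x. x \<in> \<Omega> \<Longrightarrow> pmf Q x = f x"
    using weight_pmf[of f] by metis
  have eq: "marg (pmf Q) I x = marg f I x" for I x
    using Q(2) by (rule marg_cong_weight)
  show thesis
    by (rule that[OF Q(1)]) (simp_all add: Q(2) f_def eq J LJ RJ flip: f_def)
qed

text \<open>This \<open>Q\<close> makes \<open>L\<close> and \<open>R\<close> independent with the
  marginals of \<open>P\<close> and draws the \<open>J\<close>-part from the conditional law under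
  \<open>P\<close>. Values of the two blocks that \<open>P\<close> does not charge may be charged by
  the product; there the conditional law does not exist and the \<open>J\<close>-marginal of
  \<open>P\<close> replaces it. Hence the formula for \<open>Q\<close> is claimed only on the
  support of \<open>P\<close>.\<close>

lemma independent_coupling:
  assumes P: "P \<in> all_dists n A" and part: "L \<union> J \<union> R = {1..n}" "L \<inter> R = {}" "L \<inter> J = {}" "R \<inter> J = {}"
  obtains Q where "Q \<in> all_dists n A"
    "\<And>x. x \<in> \<Omega> \<Longrightarrow> 0 < pmf P x \<Longrightarrow>
       pmf Q x = pmf P x / marg (pmf P) (L \<union> R) x * marg (pmf P) L x * marg (pmf P) R x"
    "\<And>x. x \<in> \<Omega> \<Longrightarrow> marg (pmf Q) (L \<union> R) x = marg (pmf P) L x * marg (pmf P) R x"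
    "\<And>x. x \<in> \<Omega> \<Longrightarrow> marg (pmf Q) L x = marg (pmf P) L x"
    "\<And>x. x \<in> \<Omega> \<Longrightarrow> marg (pmf Q) R x = marg (pmf P) R x"
proof -
  define c where "c x = (if marg (pmf P) (L \<union> R) x = 0 then marg (pmf P) J x
    else pmf P x / marg (pmf P) (L \<union> R) x)" for x
  define f where "f x = (marg (pmf P) L x * marg (pmf P) R x) * c x" for x
  \<comment> \<open>\<open>c\<close> is a conditional law of the \<open>J\<close>-part given the two
    blocks; both branches of its definition have mass 1 on a fibre.\<close>
  have c: "marg c (L \<union> R) x = 1" if x: "x \<in> \<Omega>" for x
  proof (cases "marg (pmf P) (L \<union> R) x = 0")
    case True
    have "marg c (L \<union> R) x = marg (marg (pmf P) J) (L \<union> R) x"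
      unfolding marg_def[of c] marg_def[of "marg _ _"]
    proof (intro sum.cong refl)
      fix y assume "y \<in> {y \<in> \<Omega>. restrict y (L \<union> R) = restrict x (L \<union> R)}"
      then have "restrict y (L \<union> R) = restrict x (L \<union> R)" by simp
      from marg_cong[OF this, of "pmf P"] True have "marg (pmf P) (L \<union> R) y = 0" by simp
      then show "c y = marg (pmf P) J y" by (simp add: c_def)
    qed
    also have "\<dots> = marg (pmf P) ((L \<union> R) \<inter> J) x"
      using x part by (intro slice) auto
    also have "(L \<union> R) \<inter> J = {}" using part by auto
    finally show ?thesis using sum_pmf[OF P] by simp
  next
    case False
    have "marg c (L \<union> R) x = marg (\<lambda>y. (1 / marg (pmf P) (L \<union> R) y) * pmf P y) (L \<union> R) x"
      unfolding marg_def[of c] marg_def[of "\<lambda>y. _ y * _ y"]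
    proof (intro sum.cong refl)
      fix y assume "y \<in> {y \<in> \<Omega>. restrict y (L \<union> R) = restrict x (L \<union> R)}"
      then have "restrict y (L \<union> R) = restrict x (L \<union> R)" by simp
      from marg_cong[OF this, of "pmf P"] False
      show "c y = 1 / marg (pmf P) (L \<union> R) y * pmf P y" by (simp add: c_def)
    qed
    also have "\<dots> = 1 / marg (pmf P) (L \<union> R) x * marg (pmf P) (L \<union> R) x"
      using x by (intro marg_cmult) (auto dest: marg_cong)
    finally show ?thesis using False by simp
  qed
  have prod: "marg (\<lambda>y. marg (pmf P) K y * w y) (L \<union> R) x = marg (pmf P) K x * marg w (L \<union> R) x"
    if "x \<in> \<Omega>" "K \<subseteq> L \<union> R" for x K w
    using that restrict_eq_mono[OF _ \<open>K \<subseteq> L \<union> R\<close>] by (intro marg_cmult) (blast intro: marg_cong)+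
  have LR: "marg f (L \<union> R) x = marg (pmf P) L x * marg (pmf P) R x" if "x \<in> \<Omega>" for x
    unfolding f_def mult.assoc using that c by (simp add: prod)
  have half: "marg f K x = marg (pmf P) K x"
    if K: "K \<union> K' = L \<union> R" "K \<inter> K' = {}"
      "\<And>x. x \<in> \<Omega> \<Longrightarrow> marg f (L \<union> R) x = marg (pmf P) K' x * marg (pmf P) K x" for x K K'
  proof -
    \<comment> \<open>\<open>slice\<close> needs index sets that cover \<open>{1..n}\<close>, which
      \<open>K\<close> and \<open>K'\<close> alone need not do, so \<open>J\<close> is attached to
      \<open>K\<close>. The weight \<open>h\<close> shares its marginal over
      \<open>L \<union> R\<close> with \<open>f\<close> and its marginal over
      \<open>K \<union> J\<close> with \<open>P\<close>; \<open>tower\<close> takes both down to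
      \<open>K\<close>.\<close>
    define h where "h x = marg (pmf P) K' x * marg (pmf P) (K \<union> J) x" for x
    have "marg h (L \<union> R) x = marg f (L \<union> R) x" if x: "x \<in> \<Omega>" for x
    proof -
      have "marg (marg (pmf P) (K \<union> J)) (L \<union> R) x = marg (pmf P) ((L \<union> R) \<inter> (K \<union> J)) x"
        using x part K by (intro slice) auto
      also have "(L \<union> R) \<inter> (K \<union> J) = K" using part K by auto
      moreover have "marg h (L \<union> R) x = marg (pmf P) K' x * marg (marg (pmf P) (K \<union> J)) (L \<union> R) x"
        unfolding h_def using K by (intro prod x) auto
      ultimately show ?thesis using K(3)[OF x] by simp
    qed
    then have "marg h K x = marg f K x" by (rule tower) (use K in auto)
    moreover have "marg h (K \<union> J) x = marg (pmf P) (K \<union> J) x" if x: "x \<in> \<Omega>" for x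
    proof -
      have "marg h (K \<union> J) x = marg (pmf P) (K \<union> J) x * marg (marg (pmf P) K') (K \<union> J) x"
        unfolding h_def mult.commute[of "marg (pmf P) K' _"] using x by (intro marg_cmult marg_cong)
      also have "marg (marg (pmf P) K') (K \<union> J) x = marg (pmf P) ((K \<union> J) \<inter> K') x"
        using x part K by (intro slice) auto
      also have "(K \<union> J) \<inter> K' = {}" using part K by auto
      finally show ?thesis using sum_pmf[OF P] by simp
    qed
    then have "marg h K x = marg (pmf P) K x" by (rule tower) auto
    ultimately show ?thesis by simp
  qed
  have L: "marg f L x = marg (pmf P) L x" for x
    by (rule half[of _ R]) (use LR part in auto)
  have R: "marg f R x = marg (pmf P) R x" for x
    by (rule half[of _ L]) (use LR part in auto)
  have "marg f {} undefined = marg (pmf P) {} undefined"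
    by (rule tower[OF L]) auto
  then have "sum f \<Omega> = 1" using sum_pmf[OF P] by simp
  moreover have "0 \<le> f x" for x by (simp add: f_def c_def marg_pmf_nonneg)
  ultimately obtain Q where Q: "Q \<in> all_dists n A" "\<And>x. x \<in> \<Omega> \<Longrightarrow> pmf Q x = f x"
    using weight_pmf[of f] by metis
  have eq: "marg (pmf Q) I x = marg f I x" for I x
    using Q(2) by (rule marg_cong_weight)
  show thesis
    by (rule that[OF Q(1)])
      (auto simp: Q(2) eq L R LR f_def c_def dest: marg_pmf_pos[of _ P "L \<union> R"])
qed

text \<open>The gap is the conditional mutual information of the two blocks given coordinate
  \<open>j\<close>.\<close>

lemma projection_gap_K_T:
  assumes "1 < b" and P: "P \<in> all_dists n A" and j: "j \<in> {2..n - 1}"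
  shows "projection_gap b P (K_T n A j)
    (ent b (pmf P) {1..j} + ent b (pmf P) {j..n} - ent b (pmf P) {j} - ent b (pmf P) {1..n})"
proof -
  let ?I = "\<lambda>i::nat. if i = 0 then {j} else if i = 1 then {1..j} else {j..n}"
  let ?J = "\<lambda>i::nat. if i = 0 then {} else {j}"
  have sets: "{1..j - 1} \<union> {j} = {1..j}" "{j + 1..n} \<union> {j} = {j..n}" using j by auto
  have K_T: "K_T n A j = {q \<in> all_dists n A. \<forall>x\<in>\<Omega>. pmf q x = marg (pmf q) {j} x *
      (marg (pmf q) {1..j} x / marg (pmf q) {j} x) * (marg (pmf q) {j..n} x / marg (pmf q) {j} x)}"
    unfolding K_T_def conditional_def sets by (auto simp: marginal_eq_marg)
  obtain Q where Q: "Q \<in> all_dists n A"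
    "\<And>x. x \<in> \<Omega> \<Longrightarrow> pmf Q x = marg (pmf P) {1..j} x * marg (pmf P) {j..n} x / marg (pmf P) {j} x"
    "\<And>x. x \<in> \<Omega> \<Longrightarrow> marg (pmf Q) {1..j} x = marg (pmf P) {1..j} x"
    "\<And>x. x \<in> \<Omega> \<Longrightarrow> marg (pmf Q) {j..n} x = marg (pmf P) {j..n} x"
    "\<And>x. x \<in> \<Omega> \<Longrightarrow> marg (pmf Q) {j} x = marg (pmf P) {j} x"
  proof (rule markov_coupling[OF P, of "{1..j - 1}" "{j}" "{j + 1..n}"])
    show "{1..j - 1} \<union> {j} \<union> {j + 1..n} = {1..n}" using j by auto
  qed (auto simp only: sets, auto)
  show ?thesis
  proof (rule projection_gapI[where Q = Q and I = ?I and J = ?J])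
    show "Q \<in> K_T n A j" using Q by (simp add: K_T)
    show "pmf q x = (\<Prod>i<3. marg (pmf q) (?I i) x / marg (pmf q) (?J i) x)"
      if "q \<in> K_T n A j" "x \<in> \<Omega>" for q x
    proof -
      have q: "q \<in> all_dists n A" using that by (simp add: K_T_def)
      have "(\<Prod>i<3. marg (pmf q) (?I i) x / marg (pmf q) (?J i) x) = marg (pmf q) {j} x *
          (marg (pmf q) {1..j} x / marg (pmf q) {j} x) * (marg (pmf q) {j..n} x / marg (pmf q) {j} x)"
        using sum_pmf[OF q] by (simp add: eval_nat_numeral del: times_divide_eq_left times_divide_eq_right)
      then show ?thesis using that unfolding K_T by simp
    qed
  qed (use assms Q in \<open>auto simp: eval_nat_numeral ent_empty sum_pmf\<close>)
qed

text \<open>The gap is the mutual information of the two blocks. The joint entropy cancels, since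
  the factor conditioned on all other coordinates is kept from \<open>P\<close>.\<close>

lemma projection_gap_K_H:
  assumes "1 < b" and P: "P \<in> all_dists n A" and j: "j \<in> {2..n - 1}"
  shows "projection_gap b P (K_H n A j)
    (ent b (pmf P) {1..j - 1} + ent b (pmf P) {j + 1..n} - ent b (pmf P) ({1..n} - {j}))"
proof -
  let ?N = "{1..n} - {j}"
  let ?I = "\<lambda>i::nat. if i = 0 then {1..n} else if i = 1 then {1..j - 1} else {j + 1..n}"
  let ?J = "\<lambda>i::nat. if i = 0 then ?N else {}"
  have sets: "{j} \<union> ?N = {1..n}" "{1..j - 1} \<union> {j + 1..n} = ?N" using j by auto
  have K_H: "K_H n A j = {q \<in> all_dists n A. \<forall>x\<in>\<Omega>. pmf q x =
      pmf q x / marg (pmf q) ?N x * marg (pmf q) {1..j - 1} x * marg (pmf q) {j + 1..n} x}"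
    unfolding K_H_def conditional_def sets
    by (intro Collect_cong conj_cong ball_cong refl) (simp add: marginal_eq_marg marg_full[simplified])
  obtain Q where Q: "Q \<in> all_dists n A"
    "\<And>x. x \<in> \<Omega> \<Longrightarrow> 0 < pmf P x \<Longrightarrow>
       pmf Q x = pmf P x / marg (pmf P) ?N x * marg (pmf P) {1..j - 1} x * marg (pmf P) {j + 1..n} x"
    "\<And>x. x \<in> \<Omega> \<Longrightarrow> marg (pmf Q) ?N x = marg (pmf P) {1..j - 1} x * marg (pmf P) {j + 1..n} x"
    "\<And>x. x \<in> \<Omega> \<Longrightarrow> marg (pmf Q) {1..j - 1} x = marg (pmf P) {1..j - 1} x"
    "\<And>x. x \<in> \<Omega> \<Longrightarrow> marg (pmf Q) {j + 1..n} x = marg (pmf P) {j + 1..n} x"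
  proof (rule independent_coupling[OF P, of "{1..j - 1}" "{j}" "{j + 1..n}"])
    show "{1..j - 1} \<union> {j} \<union> {j + 1..n} = {1..n}" using j by auto
  qed (auto simp only: sets, auto)
  \<comment> \<open>The marginal over \<open>?N\<close> is the product of the block marginals, so
    the factorisation is a cancellation; where that marginal is 0, \<open>marg_ge\<close> makes
    \<open>pmf Q x\<close> vanish too.\<close>
  have mem: "Q \<in> K_H n A j"
    using Q(1,3-5) marg_ge[of "pmf Q" _ ?N] by (force simp: K_H)
  show ?thesis
  proof (rule projection_gapI[where Q = Q and I = ?I and J = ?J])
    show "Q \<in> K_H n A j" by fact
    show "pmf q x = (\<Prod>i<3. marg (pmf q) (?I i) x / marg (pmf q) (?J i) x)"
      if "q \<in> K_H n A j" "x \<in> \<Omega>" for q x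
    proof -
      have q: "q \<in> all_dists n A" using that by (simp add: K_H_def)
      have "(\<Prod>i<3. marg (pmf q) (?I i) x / marg (pmf q) (?J i) x) =
          pmf q x / marg (pmf q) ?N x * marg (pmf q) {1..j - 1} x * marg (pmf q) {j + 1..n} x"
        using sum_pmf[OF q] that(2) by (simp add: eval_nat_numeral marg_full[simplified])
      then show ?thesis using that unfolding K_H by simp
    qed
  qed (use assms Q in \<open>auto simp: eval_nat_numeral ent_empty sum_pmf marg_full[simplified]\<close>)
qed

section \<open>Divergence and likelihood\<close>

text \<open>The complement of the support of \<open>q\<close> is its largest null set, so absolute
  continuity is inclusion of supports, to be tested only on \<Omega>, where \<open>p\<close>
  lives.\<close>

lemma absolutely_continuous_iff_dominates:
  assumes "p \<in> all_dists n A"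
  shows "absolutely_continuous (measure_pmf q) (measure_pmf p) \<longleftrightarrow> dominates q p"
proof -
  have "absolutely_continuous (measure_pmf q) (measure_pmf p) \<longleftrightarrow> set_pmf p \<subseteq> set_pmf q"
  proof
    assume ac: "absolutely_continuous (measure_pmf q) (measure_pmf p)"
    have "- set_pmf q \<in> null_sets (measure_pmf q)"
      by (simp add: null_sets_def measure_pmf.emeasure_eq_measure measure_pmf_zero_iff)
    with ac have "- set_pmf q \<in> null_sets (measure_pmf p)"
      by (auto simp: absolutely_continuous_def)
    then have "measure_pmf.prob p (- set_pmf q) = 0"
      by (simp add: null_sets_def measure_pmf.emeasure_eq_measure)
    then show "set_pmf p \<subseteq> set_pmf q" by (auto simp: measure_pmf_zero_iff)
  next
    assume "set_pmf p \<subseteq> set_pmf q"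
    then show "absolutely_continuous (measure_pmf q) (measure_pmf p)"
      by (auto simp: absolutely_continuous_def null_sets_def measure_pmf.emeasure_eq_measure
          measure_pmf_zero_iff)
  qed
  also have "\<dots> \<longleftrightarrow> dominates q p"
    using assms by (auto simp: dominates_def all_dists_def set_pmf_iff pmf_positive_iff subset_iff)
  finally show ?thesis .
qed

lemma KL_divergence_pmf:
  assumes "1 < b" "p \<in> all_dists n A" "dominates q p"
  shows "KL_divergence b (measure_pmf q) (measure_pmf p) = mean_log b p p - mean_log b p q"
proof -
  have pos: "0 < pmf q x" if "0 < pmf p x" for x
  proof -
    have "x \<in> \<Omega>" using that assms(2) by (auto simp: all_dists_def pmf_positive_iff)
    then show ?thesis using assms(3) that by (auto simp: dominates_def)
  qed
  have p0: "pmf p x = 0" if "pmf q x = 0" for x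
    using pos[of x] that pmf_nonneg[of p x] by linarith
  \<comment> \<open>The quotient is a density of \<open>p\<close> although \<open>q\<close> may
    vanish at some points, because \<open>p\<close> vanishes there as well.\<close>
  have "density (measure_pmf q) (\<lambda>x. pmf p x / pmf q x) = measure_pmf p"
    unfolding measure_pmf_eq_density
    using p0 by (subst density_density_eq)
      (auto intro!: arg_cong2[where f = density] simp: ennreal_mult[symmetric] fun_eq_iff)
  then have "KL_divergence b (measure_pmf q) (measure_pmf p) =
      (\<integral>x. pmf p x / pmf q x * log b (pmf p x / pmf q x) \<partial>measure_pmf q)"
    using sigma_finite_measure.KL_density[OF prob_space_imp_sigma_finite[OF prob_space_measure_pmf],
        of b "\<lambda>x. pmf p x / pmf q x" q] assms(1) by simp
  also have "\<dots> = (\<Sum>x\<in>\<Omega>. pmf p x / pmf q x * log b (pmf p x / pmf q x) * pmf q x)"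
    using assms(2) pos p0
    by (intro integral_measure_pmf_real) (auto simp: all_dists_def set_pmf_iff)
  also have "\<dots> = (\<Sum>x\<in>\<Omega>. pmf p x * log b (pmf p x) - pmf p x * log b (pmf q x))"
  proof (intro sum.cong refl)
    fix x
    show "pmf p x / pmf q x * log b (pmf p x / pmf q x) * pmf q x =
        pmf p x * log b (pmf p x) - pmf p x * log b (pmf q x)"
    proof (cases "pmf p x = 0")
      case False
      then have "0 < pmf p x" using pmf_nonneg[of p x] by linarith
      with pos[of x] have "log b (pmf p x / pmf q x) = log b (pmf p x) - log b (pmf q x)" "pmf q x \<noteq> 0"
        by (simp_all add: log_divide_pos)
      then show ?thesis by (simp add: right_diff_distrib[symmetric] del: right_diff_distrib)
    qed simp
  qed
  also have "\<dots> = mean_log b p p - mean_log b p q"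
    by (simp add: mean_log_def sum_subtractf)
  finally show ?thesis .
qed

text \<open>Elements that do not dominate \<open>p\<close> have infinite divergence; on the others
  the divergence is the loss in \<open>mean_log\<close>, which is least at the projection.\<close>

lemma INF_divergence:
  assumes "1 < b" "p \<in> all_dists n A" "projection_gap b p C d"
  shows "(INF q\<in>C. divergence b p q) = ereal d"
proof -
  obtain Q where Q: "Q \<in> C" "dominates Q p" "mean_log b p p - mean_log b p Q = d"
      "\<And>q. q \<in> C \<Longrightarrow> dominates q p \<Longrightarrow> mean_log b p q \<le> mean_log b p Q"
    using assms(3) unfolding projection_gap_def by blast
  have div: "divergence b p q = (if dominates q p then ereal (mean_log b p p - mean_log b p q) else \<infinity>)" for q
    using assms by (simp add: divergence_def absolutely_continuous_iff_dominates KL_divergence_pmf)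
  show ?thesis
  proof (rule antisym)
    show "(INF q\<in>C. divergence b p q) \<le> ereal d"
      using Q by (intro INF_lower2[of Q]) (auto simp: div)
    show "ereal d \<le> (INF q\<in>C. divergence b p q)"
      using Q by (intro INF_greatest) (force simp: div)
  qed
qed

section \<open>Empirical distributions and maximum likelihood\<close>

lemma empirical_pmf:
  assumes "1 \<le> m" "\<And>k. k \<in> {1..m} \<Longrightarrow> s k \<in> \<Omega>"
  obtains P where "P \<in> all_dists n A" "\<And>x. pmf P x = real (card {k \<in> {1..m}. s k = x}) / real m"
proof -
  define P where "P = map_pmf s (pmf_of_set {1..m})"
  have fin: "finite {1..m}" "{1..m} \<noteq> {}" using assms(1) by auto
  have "P \<in> all_dists n A"
    using assms fin by (auto simp: all_dists_def P_def set_pmf_of_set)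
  moreover have "pmf P x = real (card {k \<in> {1..m}. s k = x}) / real m" for x
    using fin by (simp add: P_def pmf_map measure_pmf_of_set vimage_def Int_def)
  ultimately show thesis using that by blast
qed

lemma sum_empirical:
  fixes F :: "(nat \<Rightarrow> 'c) \<Rightarrow> real"
  assumes "1 \<le> m" "\<And>k. k \<in> {1..m} \<Longrightarrow> s k \<in> \<Omega>"
    and P: "\<And>x. pmf P x = real (card {k \<in> {1..m}. s k = x}) / real m"
  shows "(\<Sum>k=1..m. F (s k)) = real m * (\<Sum>x\<in>\<Omega>. pmf P x * F x)"
proof -
  have "(\<Sum>k=1..m. F (s k)) = (\<Sum>x\<in>\<Omega>. \<Sum>k\<in>{k \<in> {1..m}. s k = x}. F (s k))"
    by (rule sum.group[symmetric]) (use assms(2) in auto)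
  also have "\<dots> = (\<Sum>x\<in>\<Omega>. real m * (pmf P x * F x))"
    using assms(1) by (intro sum.cong refl) (simp add: P)
  finally show ?thesis by (simp add: sum_distrib_left)
qed

text \<open>A \<open>q\<close> dominating the empirical distribution has likelihood
  \<open>b powr (real m * mean_log b P q)\<close>, any other has likelihood 0. So the supremum is
  attained at the projection.\<close>

lemma SUP_likelihood:
  assumes "1 < b" "1 \<le> m" and s: "\<And>k. k \<in> {1..m} \<Longrightarrow> s k \<in> \<Omega>"
    and P: "\<And>x. pmf P x = real (card {k \<in> {1..m}. s k = x}) / real m"
    and d: "projection_gap b P C d"
  shows "(SUP q\<in>C. likelihood m s q) = b powr (real m * (mean_log b P P - d))"
proof -
  obtain Q where Q: "Q \<in> C" "dominates Q P" "mean_log b P P - mean_log b P Q = d"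
      "\<And>q. q \<in> C \<Longrightarrow> dominates q P \<Longrightarrow> mean_log b P q \<le> mean_log b P Q"
    using d unfolding projection_gap_def by blast
  have "0 < pmf P x \<longleftrightarrow> (\<exists>k\<in>{1..m}. s k = x)" for x
    using \<open>1 \<le> m\<close> by (auto simp: P zero_less_divide_iff card_gt_0_iff)
  then have dom: "dominates q P \<longleftrightarrow> (\<forall>k\<in>{1..m}. 0 < pmf q (s k))" for q
    using s by (auto simp: dominates_def)
  have like: "likelihood m s q = b powr (real m * mean_log b P q)" if "dominates q P" for q
  proof -
    have "likelihood m s q = (\<Prod>k=1..m. b powr log b (pmf q (s k)))"
      using that \<open>1 < b\<close> unfolding likelihood_def dom by (intro prod.cong) auto
    also have "\<dots> = b powr (\<Sum>k=1..m. log b (pmf q (s k)))"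
      using \<open>1 < b\<close> by (simp add: powr_sum)
    finally show ?thesis 
      unfolding mean_log_def using sum_empirical[OF \<open>1 \<le> m\<close> s P, of "\<lambda>x. log b (pmf q x)"] by simp
  qed
  have zero: "likelihood m s q = 0" if "\<not> dominates q P" for q
    using that unfolding dom likelihood_def by (auto simp: not_less)
  have "(SUP q\<in>C. likelihood m s q) = likelihood m s Q"
  proof (rule cSup_eq_maximum)
    fix y assume "y \<in> likelihood m s ` C"
    then obtain q where "q \<in> C" "y = likelihood m s q" by blast
    then show "y \<le> likelihood m s Q"
      using \<open>1 < b\<close> Q(2,4) by (cases "dominates q P") (auto simp: like zero mult_left_mono)
  qed (use Q in auto)
  then show ?thesis using Q by (simp add: like flip: Q(3))
qed

text \<open>The class of all distributions has gap 0, so the exponents differ only by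
  \<open>real m * D (pmf P)\<close>. \<open>D\<close> acts on weights rather than distributions, so
  that relative frequencies can be inserted for every \<open>m\<close>, even for
  \<open>m = 0\<close>, where they are all 0.\<close>

lemma gen_likelihood_ratio_empirical:
  assumes "1 < b" "1 \<le> m" and s: "\<And>k. k \<in> {1..m} \<Longrightarrow> s k \<in> \<Omega>"
    and gap: "\<And>P. P \<in> all_dists n A \<Longrightarrow> projection_gap b P C (D (pmf P))"
  shows "1 / real m * gen_likelihood_ratio b (all_dists n A) C m s =
    D (\<lambda>x. real (card {k \<in> {1..m}. s k = x}) / real m)"
proof -
  obtain P where P: "P \<in> all_dists n A" "\<And>x. pmf P x = real (card {k \<in> {1..m}. s k = x}) / real m"
    using empirical_pmf[of m s] assms by blast
  have "gen_likelihood_ratio b (all_dists n A) C m s =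
      log b (b powr (real m * (mean_log b P P - 0)) / b powr (real m * (mean_log b P P - D (pmf P))))"
    unfolding gen_likelihood_ratio_def
    by (subst (1 2) SUP_likelihood[OF assms(1,2) s P(2)])
      (auto intro: gap P(1) projection_gap_all_dists assms(1))
  also have "\<dots> = real m * D (pmf P)"
    using \<open>1 < b\<close> by (simp add: powr_diff[symmetric] algebra_simps)
  also have "pmf P = (\<lambda>x. real (card {k \<in> {1..m}. s k = x}) / real m)"
    using P(2) by blast
  finally show ?thesis using \<open>1 \<le> m\<close> by simp
qed

section \<open>Entropy\<close>

text \<open>This form shows the entropy as a finite sum of terms \<open>t * log b t\<close> in the
  fibre sums \<open>t\<close>, from which its continuity is read off.\<close>

lemma ent_eq_sum_fibers:
  "ent b u I = - (\<Sum>z\<in>(\<lambda>x. restrict x I) ` \<Omega>.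
     (\<Sum>x\<in>{x \<in> \<Omega>. restrict x I = z}. u x) * log b (\<Sum>x\<in>{x \<in> \<Omega>. restrict x I = z}. u x))"
proof -
  have "(\<Sum>x\<in>\<Omega>. u x * log b (marg u I x)) = (\<Sum>z\<in>(\<lambda>x. restrict x I) ` \<Omega>.
      \<Sum>x\<in>{x \<in> \<Omega>. restrict x I = z}. u x * log b (marg u I x))"
    by (rule sum.image_gen) simp
  also have "\<dots> = (\<Sum>z\<in>(\<lambda>x. restrict x I) ` \<Omega>. (\<Sum>x\<in>{x \<in> \<Omega>. restrict x I = z}. u x) *
      log b (\<Sum>x\<in>{x \<in> \<Omega>. restrict x I = z}. u x))"
    unfolding sum_distrib_right by (intro sum.cong refl) (simp add: marg_def)
  finally show ?thesis by (simp add: ent_def)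
qed

text \<open>Entropy depends only on the partition that a variable induces. The map \<open>g\<close>
  covers single coordinates and restricted tuples alike, whose value types differ.\<close>

lemma entropy_eq_ent:
  fixes M :: "'w measure" and g :: "(nat \<Rightarrow> 'c) \<Rightarrow> 'd"
  assumes "information_space M b"
    and p: "p \<in> all_dists n A"
    and Z: "distributed M (count_space \<Omega>) Z (\<lambda>x. ennreal (pmf p x))"
    and g: "\<And>x y. x \<in> \<Omega> \<Longrightarrow> y \<in> \<Omega> \<Longrightarrow> g x = g y \<longleftrightarrow> restrict x I = restrict y I"
    and Y: "\<And>\<omega>. \<omega> \<in> space M \<Longrightarrow> Y \<omega> = g (Z \<omega>)"
  shows "prob_space.entropy M b (count_space (Y ` space M)) Y = ent b (pmf p) I"
proof -
  interpret information_space M b by fact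
  have meas: "Z \<in> measurable M (count_space \<Omega>)" using Z by (rule distributed_measurable)
  then have Zin: "Z \<omega> \<in> \<Omega>" if "\<omega> \<in> space M" for \<omega>
    using measurable_space[OF meas that] by simp
  have vimage: "Y -` {z} \<inter> space M = Z -` {x \<in> \<Omega>. g x = z} \<inter> space M" for z
    using Zin Y by auto
  have prob: "measure M (Y -` {z} \<inter> space M) = (\<Sum>x\<in>{x \<in> \<Omega>. g x = z}. pmf p x)" for z
  proof -
    have "emeasure M (Y -` {z} \<inter> space M) = (\<integral>\<^sup>+x. ennreal (pmf p x) * indicator {x \<in> \<Omega>. g x = z} x \<partial>count_space \<Omega>)"
      unfolding vimage by (rule distributed_emeasure[OF Z]) simp
    also have "\<dots> = (\<Sum>x\<in>\<Omega>. ennreal (pmf p x) * indicator {x \<in> \<Omega>. g x = z} x)"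
      by (rule nn_integral_count_space_finite) simp
    also have "\<dots> = (\<Sum>x\<in>{x \<in> \<Omega>. g x = z}. ennreal (pmf p x))"
      by (rule sum.mono_neutral_cong_right) (auto simp: indicator_def)
    also have "\<dots> = ennreal (\<Sum>x\<in>{x \<in> \<Omega>. g x = z}. pmf p x)"
      by (rule sum_ennreal) simp
    finally show ?thesis by (simp add: measure_def sum_nonneg)
  qed
  have "simple_function M Y"
    unfolding simple_function_def
  proof
    have "Y ` space M \<subseteq> g ` \<Omega>" using Zin Y by auto
    then show "finite (Y ` space M)" by (rule finite_subset) simp
    show "\<forall>z\<in>Y ` space M. Y -` {z} \<inter> space M \<in> sets M"
      unfolding vimage by (intro ballI measurable_sets[OF meas]) auto
  qed
  then have "\<H>(Y) = - (\<Sum>z\<in>Y ` space M. measure M (Y -` {z} \<inter> space M) * log b (measure M (Y -` {z} \<inter> space M)))"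
    by (intro entropy_simple_distributed simple_distributedI) auto
  \<comment> \<open>The library entropy sums over attained values; the further values of
    \<open>g\<close> have empty preimage and contribute 0.\<close>
  also have "(\<Sum>z\<in>Y ` space M. measure M (Y -` {z} \<inter> space M) * log b (measure M (Y -` {z} \<inter> space M))) =
      (\<Sum>z\<in>g ` \<Omega>. measure M (Y -` {z} \<inter> space M) * log b (measure M (Y -` {z} \<inter> space M)))"
  proof (rule sum.mono_neutral_left)
    show "\<forall>z\<in>g ` \<Omega> - Y ` space M. measure M (Y -` {z} \<inter> space M) * log b (measure M (Y -` {z} \<inter> space M)) = 0"
    proof
      fix z assume "z \<in> g ` \<Omega> - Y ` space M"
      then have "z \<notin> Y ` space M" by blast
      then have "Y -` {z} \<inter> space M = {}" by blast
      then show "measure M (Y -` {z} \<inter> space M) * log b (measure M (Y -` {z} \<inter> space M)) = 0" by simp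
    qed
  qed (use Zin Y in auto)
  also have "\<dots> = (\<Sum>z\<in>g ` \<Omega>. \<Sum>x\<in>{x \<in> \<Omega>. g x = z}. pmf p x * log b (marg (pmf p) I x))"
  proof (intro sum.cong refl)
    fix z assume "z \<in> g ` \<Omega>"
    have "marg (pmf p) I x = measure M (Y -` {z} \<inter> space M)" if "x \<in> {x \<in> \<Omega>. g x = z}" for x
    proof -
      have "{y \<in> \<Omega>. restrict y I = restrict x I} = {y \<in> \<Omega>. g y = z}"
        using that g by auto
      then show ?thesis by (simp add: marg_def prob)
    qed
    then show "measure M (Y -` {z} \<inter> space M) * log b (measure M (Y -` {z} \<inter> space M)) =
        (\<Sum>x\<in>{x \<in> \<Omega>. g x = z}. pmf p x * log b (marg (pmf p) I x))"
      unfolding prob sum_distrib_right by (intro sum.cong refl) simp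
  qed
  also have "\<dots> = (\<Sum>x\<in>\<Omega>. pmf p x * log b (marg (pmf p) I x))"
    by (rule sum.image_gen[symmetric]) simp
  finally show ?thesis by (simp add: ent_def)
qed

lemma O_information_eq_ent:
  assumes "information_space M b"
    and p: "p \<in> all_dists n A"
    and Z: "distributed M (count_space \<Omega>) (\<lambda>\<omega>. \<lambda>i\<in>{1..n}. X i \<omega>) (\<lambda>x. ennreal (pmf p x))"
  shows "information_space.O_information M b n X = (real n - 2) * ent b (pmf p) {1..n} +
    (\<Sum>j=1..n. ent b (pmf p) {j} - ent b (pmf p) ({1..n} - {j}))"
proof -
  interpret information_space M b by fact
  note entropy = entropy_eq_ent[OF assms]
  have joint: "\<H>(\<lambda>\<omega>. \<lambda>i\<in>{1..n}. X i \<omega>) = ent b (pmf p) {1..n}"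
    by (rule entropy[where g = "\<lambda>x. x"]) (use space_eqI in auto)
  have single: "\<H>(X j) = ent b (pmf p) {j}" if "j \<in> {1..n}" for j
    by (rule entropy[where g = "\<lambda>x. x j"]) (use that in \<open>auto simp: restrict_eq_iff\<close>)
  have rest: "\<H>(\<lambda>\<omega>. \<lambda>i\<in>{1..n} - {j}. X i \<omega>) = ent b (pmf p) ({1..n} - {j})" for j
    by (rule entropy[where g = "\<lambda>x. restrict x ({1..n} - {j})"]) (auto simp: fun_eq_iff restrict_def)
  show ?thesis
    unfolding O_information_def joint rest
    by (intro arg_cong2[where f = "(+)"] sum.cong refl) (simp add: single)
qed

text \<open>The summands contain increments of the prefix entropies and of the suffix entropies.
  Both telescope, and what is left are the terms for the first and the last coordinate, which the
  sum over \<open>{2..n - 1}\<close> omits.\<close>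

lemma ent_telescope:
  assumes "2 \<le> n"
  shows "(real n - 2) * ent b u {1..n} + (\<Sum>j=1..n. ent b u {j} - ent b u ({1..n} - {j})) =
    (\<Sum>j=2..n - 1. (ent b u {1..j - 1} + ent b u {j + 1..n} - ent b u ({1..n} - {j})) -
       (ent b u {1..j} + ent b u {j..n} - ent b u {j} - ent b u {1..n}))"
proof -
  have tele: "(\<Sum>j=2..n - 1. f j - f (j - 1)) = f (n - 1) - f 1" for f :: "nat \<Rightarrow> real"
    using assms
  proof (induction n rule: dec_induct)
    case (step m)
    then have "{2..Suc m - 1} = insert m {2..m - 1}" by auto
    with step show ?case by simp
  qed simp
  have split: "(\<Sum>j=1..n. f j) = f 1 + (\<Sum>j=2..n - 1. f j) + f n" for f :: "nat \<Rightarrow> real"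
  proof -
    have "{1..n} = insert 1 (insert n {2..n - 1})" using assms by auto
    then show ?thesis using assms by simp
  qed
  have "{1..n} - {1} = {2..n}" "{1..n} - {n} = {1..n - 1}" using assms by auto
  then have sets: "ent b u ({1..n} - {1}) = ent b u {2..n}" "ent b u ({1..n} - {n}) = ent b u {1..n - 1}"
    by metis+
  \<comment> \<open>The suffix entropy at \<open>j\<close> is written with \<open>j - 1 + 1\<close>
    to fit the pattern \<open>f j - f (j - 1)\<close> of \<open>tele\<close>.\<close>
  have "(\<Sum>j=2..n - 1. (ent b u {1..j - 1} + ent b u {j + 1..n} - ent b u ({1..n} - {j})) -
       (ent b u {1..j} + ent b u {j..n} - ent b u {j} - ent b u {1..n})) =
    (\<Sum>j=2..n - 1. (ent b u {j} - ent b u ({1..n} - {j})) + ent b u {1..n} -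
       (ent b u {1..j} - ent b u {1..j - 1}) + (ent b u {j + 1..n} - ent b u {j - 1 + 1..n}))"
    by (intro sum.cong) auto
  also have "\<dots> = (\<Sum>j=2..n - 1. ent b u {j} - ent b u ({1..n} - {j})) + (real n - 2) * ent b u {1..n} -
      (ent b u {1..n - 1} - ent b u {1..1}) + (ent b u {n - 1 + 1..n} - ent b u {1 + 1..n})"
    unfolding sum.distrib sum_subtractf[of _ "\<lambda>j. ent b u {1..j} - ent b u {1..j - 1}"]
      tele[of "\<lambda>j. ent b u {1..j}"] tele[of "\<lambda>j. ent b u {j + 1..n}"]
    using assms by (simp add: of_nat_diff)
  finally show ?thesis
    using assms unfolding split sets by (simp add: numeral_2_eq_2)
qed

end

section \<open>Convergence in probability\<close>

lemma (in prob_space) tendsto_in_probI: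
  assumes "\<And>m. Y m \<in> borel_measurable M"
    and "\<And>\<epsilon>. 0 < \<epsilon> \<Longrightarrow> \<exists>h. h \<longlonglongrightarrow> 0 \<and> (\<forall>\<^sub>F m in sequentially. prob {\<omega> \<in> space M. \<bar>Y m \<omega> - c\<bar> > \<epsilon>} \<le> h m)"
  shows "tendsto_in_prob M Y c"
  unfolding tendsto_in_prob_def
proof (intro conjI allI impI assms(1))
  fix \<epsilon> :: real assume "0 < \<epsilon>"
  then obtain h where h: "h \<longlonglongrightarrow> 0" "\<forall>\<^sub>F m in sequentially. prob {\<omega> \<in> space M. \<bar>Y m \<omega> - c\<bar> > \<epsilon>} \<le> h m"
    using assms(2) by blast
  show "(\<lambda>m. prob {\<omega> \<in> space M. \<bar>Y m \<omega> - c\<bar> > \<epsilon>}) \<longlonglongrightarrow> 0"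
    by (rule tendsto_sandwich[OF _ h(2) tendsto_const h(1)]) simp
qed

lemma tendsto_in_probD:
  "tendsto_in_prob M Y c \<Longrightarrow> 0 < \<epsilon> \<Longrightarrow> (\<lambda>m. measure M {\<omega> \<in> space M. \<bar>Y m \<omega> - c\<bar> > \<epsilon>}) \<longlonglongrightarrow> 0"
  by (simp add: tendsto_in_prob_def)

lemma (in prob_space) tendsto_in_prob_add:
  assumes "tendsto_in_prob M Y c" "tendsto_in_prob M Z d"
  shows "tendsto_in_prob M (\<lambda>m \<omega>. Y m \<omega> + Z m \<omega>) (c + d)"
proof (rule tendsto_in_probI)
  have [measurable]: "Y m \<in> borel_measurable M" "Z m \<in> borel_measurable M" for m
    using assms by (auto simp: tendsto_in_prob_def)
  show "(\<lambda>\<omega>. Y m \<omega> + Z m \<omega>) \<in> borel_measurable M" for m by simp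
  fix \<epsilon> :: real assume "0 < \<epsilon>"
  define h where "h m = prob {\<omega> \<in> space M. \<bar>Y m \<omega> - c\<bar> > \<epsilon> / 2} + prob {\<omega> \<in> space M. \<bar>Z m \<omega> - d\<bar> > \<epsilon> / 2}" for m
  have "h \<longlonglongrightarrow> 0 + 0"
    unfolding h_def using \<open>0 < \<epsilon>\<close> by (intro tendsto_add tendsto_in_probD assms) auto
  moreover have "prob {\<omega> \<in> space M. \<bar>Y m \<omega> + Z m \<omega> - (c + d)\<bar> > \<epsilon>} \<le> h m" for m
  proof -
    have "prob {\<omega> \<in> space M. \<bar>Y m \<omega> + Z m \<omega> - (c + d)\<bar> > \<epsilon>} \<le>
        prob ({\<omega> \<in> space M. \<bar>Y m \<omega> - c\<bar> > \<epsilon> / 2} \<union> {\<omega> \<in> space M. \<bar>Z m \<omega> - d\<bar> > \<epsilon> / 2})"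
    proof (rule finite_measure_mono)
      have "\<bar>y - c\<bar> > \<epsilon> / 2 \<or> \<bar>z - d\<bar> > \<epsilon> / 2" if "\<bar>y + z - (c + d)\<bar> > \<epsilon>" for y z :: real
        using that by linarith
      then show "{\<omega> \<in> space M. \<bar>Y m \<omega> + Z m \<omega> - (c + d)\<bar> > \<epsilon>} \<subseteq>
          {\<omega> \<in> space M. \<bar>Y m \<omega> - c\<bar> > \<epsilon> / 2} \<union> {\<omega> \<in> space M. \<bar>Z m \<omega> - d\<bar> > \<epsilon> / 2}"
        by blast
    qed measurable
    also have "\<dots> \<le> h m"
      unfolding h_def by (rule measure_Un_le) measurable
    finally show ?thesis .
  qed
  ultimately show "\<exists>h. h \<longlonglongrightarrow> 0 \<and>
      (\<forall>\<^sub>F m in sequentially. prob {\<omega> \<in> space M. \<bar>Y m \<omega> + Z m \<omega> - (c + d)\<bar> > \<epsilon>} \<le> h m)"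
    by (intro exI[of _ h]) auto
qed

lemma (in prob_space) tendsto_in_prob_continuous:
  assumes "tendsto_in_prob M Y c" "isCont f c" and [measurable]: "f \<in> borel_measurable borel"
  shows "tendsto_in_prob M (\<lambda>m \<omega>. f (Y m \<omega>)) (f c)"
proof (rule tendsto_in_probI)
  have [measurable]: "Y m \<in> borel_measurable M" for m
    using assms by (auto simp: tendsto_in_prob_def)
  show "(\<lambda>\<omega>. f (Y m \<omega>)) \<in> borel_measurable M" for m by simp
  fix \<epsilon> :: real assume "0 < \<epsilon>"
  with assms(2) obtain \<delta> where \<delta>: "0 < \<delta>" "\<And>y. \<bar>y - c\<bar> < \<delta> \<Longrightarrow> \<bar>f y - f c\<bar> < \<epsilon>"
    unfolding continuous_at_eps_delta dist_real_def by blast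
  \<comment> \<open>Continuity only yields a deviation of at least \<delta>; halving \<delta> makes
    the inequality strict.\<close>
  have "prob {\<omega> \<in> space M. \<bar>f (Y m \<omega>) - f c\<bar> > \<epsilon>} \<le> prob {\<omega> \<in> space M. \<bar>Y m \<omega> - c\<bar> > \<delta> / 2}" for m
  proof (rule finite_measure_mono)
    have "\<bar>y - c\<bar> > \<delta> / 2" if "\<bar>f y - f c\<bar> > \<epsilon>" for y
      using \<delta>(1) \<delta>(2)[of y] that by linarith
    then show "{\<omega> \<in> space M. \<bar>f (Y m \<omega>) - f c\<bar> > \<epsilon>} \<subseteq> {\<omega> \<in> space M. \<bar>Y m \<omega> - c\<bar> > \<delta> / 2}" by auto
  qed measurable
  moreover have "(\<lambda>m. prob {\<omega> \<in> space M. \<bar>Y m \<omega> - c\<bar> > \<delta> / 2}) \<longlonglongrightarrow> 0"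
    using \<delta>(1) by (intro tendsto_in_probD assms) simp
  ultimately show "\<exists>h. h \<longlonglongrightarrow> 0 \<and>
      (\<forall>\<^sub>F m in sequentially. prob {\<omega> \<in> space M. \<bar>f (Y m \<omega>) - f c\<bar> > \<epsilon>} \<le> h m)"
    by (intro exI conjI) auto
qed

lemma (in prob_space) tendsto_in_prob_minus:
  "tendsto_in_prob M Y c \<Longrightarrow> tendsto_in_prob M (\<lambda>m \<omega>. - Y m \<omega>) (- c)"
  by (rule tendsto_in_prob_continuous[where f = uminus]) auto

lemma (in prob_space) tendsto_in_prob_diff:
  "tendsto_in_prob M Y c \<Longrightarrow> tendsto_in_prob M Z d \<Longrightarrow> tendsto_in_prob M (\<lambda>m \<omega>. Y m \<omega> - Z m \<omega>) (c - d)"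
  using tendsto_in_prob_add[of Y c "\<lambda>m \<omega>. - Z m \<omega>" "- d"] by (simp add: tendsto_in_prob_minus)

lemma (in prob_space) tendsto_in_prob_sum:
  assumes "\<And>i. i \<in> I \<Longrightarrow> tendsto_in_prob M (Y i) (c i)"
  shows "tendsto_in_prob M (\<lambda>m \<omega>. \<Sum>i\<in>I. Y i m \<omega>) (\<Sum>i\<in>I. c i)"
  using assms
proof (induction I rule: infinite_finite_induct)
  case (insert i I)
  then show ?case by (simp add: tendsto_in_prob_add)
\<comment> \<open>Over an infinite index set both sums are 0 by convention, as over the empty
  one.\<close>
qed (simp_all add: tendsto_in_prob_def)

text \<open>The variables need agree only from \<open>m = 1\<close> on. Measurability is inherited
  from \<open>Z\<close>, so the suprema in the likelihood ratio never have to be shown measurable;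
  only index 0 is handled separately.\<close>

lemma tendsto_in_prob_cong:
  assumes "tendsto_in_prob M Z c" "Y 0 \<in> borel_measurable M"
    and "\<And>m \<omega>. 1 \<le> m \<Longrightarrow> \<omega> \<in> space M \<Longrightarrow> Y m \<omega> = Z m \<omega>"
  shows "tendsto_in_prob M Y c"
  unfolding tendsto_in_prob_def
proof (intro conjI allI impI)
  fix m
  show "Y m \<in> borel_measurable M"
  proof (cases m)
    case (Suc k)
    then have "Y m \<in> borel_measurable M \<longleftrightarrow> Z m \<in> borel_measurable M"
      using assms(3) by (intro measurable_cong) auto
    then show ?thesis using assms(1) by (simp add: tendsto_in_prob_def)
  qed (use assms in simp)
next
  fix \<epsilon> :: real assume "0 < \<epsilon>"
  then have "(\<lambda>m. measure M {\<omega> \<in> space M. \<bar>Z m \<omega> - c\<bar> > \<epsilon>}) \<longlonglongrightarrow> 0"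
    using assms(1) by (simp add: tendsto_in_prob_def)
  moreover have "\<forall>\<^sub>F m in sequentially. measure M {\<omega> \<in> space M. \<bar>Z m \<omega> - c\<bar> > \<epsilon>} =
      measure M {\<omega> \<in> space M. \<bar>Y m \<omega> - c\<bar> > \<epsilon>}"
    using eventually_ge_at_top[of 1]
    by eventually_elim (intro arg_cong[where f = "measure M"] Collect_cong conj_cong, auto simp: assms(3))
  ultimately show "(\<lambda>m. measure M {\<omega> \<in> space M. \<bar>Y m \<omega> - c\<bar> > \<epsilon>}) \<longlonglongrightarrow> 0"
    by (rule Lim_transform_eventually)
qed

text \<open>A weak law of large numbers for a triangular array: no relation between the rows
  \<open>S m\<close> is assumed, and Hoeffding's inequality is applied to the indicators within one
  row.\<close>

lemma (in prob_space) tendsto_in_prob_frequency: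
  fixes S :: "nat \<Rightarrow> nat \<Rightarrow> 'a \<Rightarrow> 'x"
  assumes indep: "\<And>m. 1 \<le> m \<Longrightarrow> indep_vars (\<lambda>_. count_space B) (S m) {1..m}"
    and prob: "\<And>m k. k \<in> {1..m} \<Longrightarrow> prob {\<omega> \<in> space M. S m k \<omega> = x} = c"
    and x: "x \<in> B"
  shows "tendsto_in_prob M (\<lambda>m \<omega>. real (card {k \<in> {1..m}. S m k \<omega> = x}) / real m) c"
proof (rule tendsto_in_probI)
  let ?X = "\<lambda>m k \<omega>. indicator {x} (S m k \<omega>) :: real"
  have S: "S m k \<in> measurable M (count_space B)" if "k \<in> {1..m}" for m k
    using indep[of m] that by (auto simp: indep_vars_def)
  have X: "?X m k \<in> borel_measurable M" if "k \<in> {1..m}" for m k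
    using S[OF that] by (rule measurable_compose) simp
  have card: "real (card {k \<in> {1..m}. S m k \<omega> = x}) = (\<Sum>k=1..m. ?X m k \<omega>)" for m \<omega>
    by (simp add: indicator_def sum.If_cases Int_def)
  show "(\<lambda>\<omega>. real (card {k \<in> {1..m}. S m k \<omega> = x}) / real m) \<in> borel_measurable M" for m
    unfolding card using X by (intro borel_measurable_divide borel_measurable_sum borel_measurable_const)
  have expect: "expectation (?X m k) = c" if "k \<in> {1..m}" for m k
  proof -
    have "expectation (?X m k) = expectation (indicator {\<omega> \<in> space M. S m k \<omega> = x})"
      by (intro Bochner_Integration.integral_cong) (auto simp: indicator_def)
    then show ?thesis using prob[OF that] by (simp add: Int_def conj_commute)
  qed
  fix \<epsilon> :: real assume "0 < \<epsilon>"
  have bound: "prob {\<omega> \<in> space M. \<bar>real (card {k \<in> {1..m}. S m k \<omega> = x}) / real m - c\<bar> > \<epsilon>} \<le>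
      2 * exp (- 2 * \<epsilon>\<^sup>2 * real m)" if "1 \<le> m" for m
  proof -
    interpret H: Hoeffding_ineq M "{1..m}" "?X m" "\<lambda>_. 0" "\<lambda>_. 1" "\<Sum>k=1..m. expectation (?X m k)"
    proof unfold_locales
      show "indep_vars (\<lambda>_. borel) (?X m) {1..m}"
        using indep[OF that] by (rule indep_vars_compose2) simp
    qed (auto simp: indicator_def)
    have "prob {\<omega> \<in> space M. \<bar>real (card {k \<in> {1..m}. S m k \<omega> = x}) / real m - c\<bar> > \<epsilon>} \<le>
        prob {\<omega> \<in> space M. \<bar>(\<Sum>k=1..m. ?X m k \<omega>) - (\<Sum>k=1..m. expectation (?X m k))\<bar> \<ge> \<epsilon> * real m}"
    proof (rule finite_measure_mono)
      have "\<bar>s / real m - c\<bar> > \<epsilon> \<Longrightarrow> \<bar>s - real m * c\<bar> \<ge> \<epsilon> * real m" for s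
        using that by (auto simp: abs_if field_simps split: if_splits)
      then show "{\<omega> \<in> space M. \<bar>real (card {k \<in> {1..m}. S m k \<omega> = x}) / real m - c\<bar> > \<epsilon>} \<subseteq>
          {\<omega> \<in> space M. \<bar>(\<Sum>k=1..m. ?X m k \<omega>) - (\<Sum>k=1..m. expectation (?X m k))\<bar> \<ge> \<epsilon> * real m}"
        unfolding card by (auto simp: expect)
      have [measurable]: "(\<lambda>\<omega>. \<Sum>k=1..m. ?X m k \<omega>) \<in> borel_measurable M"
        using X by (intro borel_measurable_sum)
      show "{\<omega> \<in> space M. \<bar>(\<Sum>k=1..m. ?X m k \<omega>) - (\<Sum>k=1..m. expectation (?X m k))\<bar> \<ge> \<epsilon> * real m} \<in> events"
        by measurable
    qed
    also have "\<dots> \<le> 2 * exp (- 2 * (\<epsilon> * real m)\<^sup>2 / (\<Sum>k=1..m. (1 - 0)\<^sup>2))"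
      using \<open>0 < \<epsilon>\<close> that by (intro H.Hoeffding_ineq_abs_ge) auto
    \<comment> \<open>Indicators take values in an interval of length 1, so the squared lengths add
      up to \<open>m\<close>.\<close>
    also have "- 2 * (\<epsilon> * real m)\<^sup>2 / (\<Sum>k=1..m. (1 - 0)\<^sup>2) = - 2 * \<epsilon>\<^sup>2 * real m"
      using that by (simp add: power2_eq_square)
    finally show ?thesis .
  qed
  have "(\<lambda>m. 2 * exp (- 2 * \<epsilon>\<^sup>2 * real m)) \<longlonglongrightarrow> 0"
    using \<open>0 < \<epsilon>\<close> by real_asymp
  then show "\<exists>h. h \<longlonglongrightarrow> 0 \<and> (\<forall>\<^sub>F m in sequentially.
      prob {\<omega> \<in> space M. \<bar>real (card {k \<in> {1..m}. S m k \<omega> = x}) / real m - c\<bar> > \<epsilon>} \<le> h m)"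
    using bound by (intro exI[of _ "\<lambda>m. 2 * exp (- 2 * \<epsilon>\<^sup>2 * real m)"] conjI eventually_sequentiallyI[of 1])
qed

text \<open>The absolute value makes the entropy function \<open>t \<mapsto> t log t\<close> continuous on the whole line.\<close>

lemma isCont_times_log_abs:
  fixes b c :: real
  shows "isCont (\<lambda>t. t * log b \<bar>t\<bar>) c"
proof (cases "c = 0")
  case True
  have "((\<lambda>t::real. t * ln \<bar>t\<bar>) \<longlongrightarrow> 0) (at 0)" by real_asymp
  then have "((\<lambda>t::real. t * ln \<bar>t\<bar> / ln b) \<longlongrightarrow> 0) (at 0)"
    by (rule tendsto_divide_zero)
  then show ?thesis using True by (simp add: isCont_def log_def)
next
  case False
  then show ?thesis unfolding log_def divide_inverse by (intro continuous_intros) auto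
qed

section \<open>Convergence of empirical entropies and likelihood ratios\<close>

context finite_product
begin

text \<open>The entropy is a finite sum of continuous functions of fibre sums, and these converge as
  finite sums of frequencies. Nonnegativity allows the absolute value to be inserted.\<close>

lemma tendsto_in_prob_ent:
  fixes M :: "'w measure" and Y :: "nat \<Rightarrow> 'w \<Rightarrow> (nat \<Rightarrow> 'c) \<Rightarrow> real"
  assumes "prob_space M"
    and "\<And>x. x \<in> \<Omega> \<Longrightarrow> tendsto_in_prob M (\<lambda>m \<omega>. Y m \<omega> x) (u x)"
    and Y: "\<And>m \<omega> x. 0 \<le> Y m \<omega> x" and u: "\<And>x. 0 \<le> u x"
  shows "tendsto_in_prob M (\<lambda>m \<omega>. ent b (Y m \<omega>) I) (ent b u I)"
proof -
  interpret prob_space M by fact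
  let ?fib = "\<lambda>z v. \<Sum>x\<in>{x \<in> \<Omega>. restrict x I = z}. v x"
  have ent: "ent b v I = - (\<Sum>z\<in>(\<lambda>x. restrict x I) ` \<Omega>. ?fib z v * log b \<bar>?fib z v\<bar>)"
    if "\<And>x. 0 \<le> v x" for v
    unfolding ent_eq_sum_fibers using that by (simp add: sum_nonneg)
  show ?thesis
    unfolding ent[OF Y] ent[OF u]
  proof (intro tendsto_in_prob_minus tendsto_in_prob_sum)
    fix z
    have "tendsto_in_prob M (\<lambda>m \<omega>. ?fib z (Y m \<omega>)) (?fib z u)"
      using assms(2) by (intro tendsto_in_prob_sum) auto
    then show "tendsto_in_prob M (\<lambda>m \<omega>. ?fib z (Y m \<omega>) * log b \<bar>?fib z (Y m \<omega>)\<bar>) (?fib z u * log b \<bar>?fib z u\<bar>)"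
      by (rule tendsto_in_prob_continuous[where f = "\<lambda>t. t * log b \<bar>t\<bar>"]) (simp_all add: isCont_times_log_abs)
  qed
qed

lemma tendsto_in_prob_likelihood_ratio:
  fixes M :: "'w measure" and S :: "nat \<Rightarrow> nat \<Rightarrow> 'w \<Rightarrow> nat \<Rightarrow> 'c"
  assumes "1 < b" and S: "\<And>m k \<omega>. k \<in> {1..m} \<Longrightarrow> \<omega> \<in> space M \<Longrightarrow> S m k \<omega> \<in> \<Omega>"
    and gap: "\<And>P. P \<in> all_dists n A \<Longrightarrow> projection_gap b P C (D (pmf P))"
    and D: "tendsto_in_prob M (\<lambda>m \<omega>. D (\<lambda>x. real (card {k \<in> {1..m}. S m k \<omega> = x}) / real m)) c"
  shows "tendsto_in_prob M
    (\<lambda>m \<omega>. 1 / real m * gen_likelihood_ratio b (all_dists n A) C m (\<lambda>k. S m k \<omega>)) c"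
proof (rule tendsto_in_prob_cong[OF D])
  fix m :: nat and \<omega> assume "1 \<le> m" "\<omega> \<in> space M"
  then show "1 / real m * gen_likelihood_ratio b (all_dists n A) C m (\<lambda>k. S m k \<omega>) =
      D (\<lambda>x. real (card {k \<in> {1..m}. S m k \<omega> = x}) / real m)"
    using assms(1) S gap by (intro gen_likelihood_ratio_empirical) auto
\<comment> \<open>For \<open>m = 0\<close> the prefactor \<open>1 / real 0\<close> is 0, so the
  variable is constant and hence measurable.\<close>
qed simp

end

theorem corollary4:
  fixes M :: "'w measure" and b :: real and n :: nat
    and A :: "nat \<Rightarrow> 'c set" and X :: "nat \<Rightarrow> 'w \<Rightarrow> 'c" and p :: "(nat \<Rightarrow> 'c) pmf"
    and S :: "nat \<Rightarrow> nat \<Rightarrow> 'w \<Rightarrow> nat \<Rightarrow> 'c"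
  assumes "information_space M b"
    and "n \<ge> 2"
    and "\<And>i. i \<in> {1..n} \<Longrightarrow> finite (A i)"
    and "p \<in> all_dists n A"
    and "distributed M (count_space (product_space n A)) (\<lambda>\<omega>. \<lambda>i\<in>{1..n}. X i \<omega>) (\<lambda>x. ennreal (pmf p x))"
    and "\<And>m. m \<ge> 1 \<Longrightarrow>
           prob_space.indep_vars M (\<lambda>_. count_space (product_space n A)) (S m) {1..m}"
    and "\<And>m k. m \<ge> 1 \<Longrightarrow> k \<in> {1..m} \<Longrightarrow>
           distributed M (count_space (product_space n A)) (S m k) (\<lambda>x. ennreal (pmf p x))"
  shows "\<exists>L_H L_T :: nat \<Rightarrow> real.
    (\<forall>j\<in>{2..n - 1}.
       tendsto_in_prob M
         (\<lambda>m \<omega>. 1 / real m * gen_likelihood_ratio b (all_dists n A) (K_H n A j) m (\<lambda>k. S m k \<omega>)) (L_H j) \<and>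
       tendsto_in_prob M
         (\<lambda>m \<omega>. 1 / real m * gen_likelihood_ratio b (all_dists n A) (K_T n A j) m (\<lambda>k. S m k \<omega>)) (L_T j)) \<and>
    information_space.O_information M b n X = (\<Sum>j=2..n - 1. L_H j - L_T j) \<and>
    ereal (information_space.O_information M b n X) =
      (\<Sum>j=2..n - 1. (INF q\<in>K_H n A j. divergence b p q) - (INF q\<in>K_T n A j. divergence b p q))"
proof -
  interpret information_space M b by fact
  interpret finite_product n A by unfold_locales (use assms(3) in auto)
  let ?freq = "\<lambda>m \<omega> x. real (card {k \<in> {1..m}. S m k \<omega> = x}) / real m"
  \<comment> \<open>\<open>D_H\<close> and \<open>D_T\<close> are the mutual information of the
    blocks around \<open>j\<close> and its version conditioned on coordinate \<open>j\<close>, as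
    functionals of a weight; they are evaluated both at \<open>p\<close> and at the empirical
    frequencies.\<close>
  define D_H where "D_H j u = ent b u {1..j - 1} + ent b u {j + 1..n} - ent b u ({1..n} - {j})" for j u
  define D_T where "D_T j u = ent b u {1..j} + ent b u {j..n} - ent b u {j} - ent b u {1..n}" for j u
  have gap_H: "projection_gap b P (K_H n A j) (D_H j (pmf P))"
    and gap_T: "projection_gap b P (K_T n A j) (D_T j (pmf P))"
    if "P \<in> all_dists n A" "j \<in> {2..n - 1}" for P j
    unfolding D_H_def D_T_def
    using projection_gap_K_H[OF b_gt_1 that] projection_gap_K_T[OF b_gt_1 that] by auto
  have dist: "distributed M (count_space \<Omega>) (S m k) (\<lambda>x. ennreal (pmf p x))" if "k \<in> {1..m}" for m k :: nat
    using assms(7)[of m k] that by simp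
  have S: "S m k \<omega> \<in> \<Omega>" if "k \<in> {1..m}" "\<omega> \<in> space M" for m k :: nat and \<omega>
    using measurable_space[OF distributed_measurable[OF dist]] that by fastforce
  have freq: "tendsto_in_prob M (\<lambda>m \<omega>. ?freq m \<omega> x) (pmf p x)" if x: "x \<in> \<Omega>" for x
  proof (rule tendsto_in_prob_frequency[where B = \<Omega>])
    fix m k :: nat assume "k \<in> {1..m}"
    have "emeasure M (S m k -` {x} \<inter> space M) = (\<integral>\<^sup>+y. ennreal (pmf p y) * indicator {x} y \<partial>count_space \<Omega>)"
      by (rule distributed_emeasure[OF dist[OF \<open>k \<in> {1..m}\<close>]]) (use x in simp)
    also have "\<dots> = ennreal (pmf p x)"
      using x by (simp add: nn_integral_count_space_finite)
    finally have "prob (S m k -` {x} \<inter> space M) = pmf p x" by (simp add: measure_def)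
    also have "S m k -` {x} \<inter> space M = {\<omega> \<in> space M. S m k \<omega> = x}" by auto
    finally show "prob {\<omega> \<in> space M. S m k \<omega> = x} = pmf p x" .
  qed (use assms(6) x in auto)
  have ent: "tendsto_in_prob M (\<lambda>m \<omega>. ent b (?freq m \<omega>) I) (ent b (pmf p) I)" for I
    by (rule tendsto_in_prob_ent[OF prob_space_axioms freq]) auto
  have lim_H: "tendsto_in_prob M
      (\<lambda>m \<omega>. 1 / real m * gen_likelihood_ratio b (all_dists n A) (K_H n A j) m (\<lambda>k. S m k \<omega>)) (D_H j (pmf p))"
    if "j \<in> {2..n - 1}" for j
    by (rule tendsto_in_prob_likelihood_ratio[OF b_gt_1 S gap_H])
      (use that in \<open>auto simp only: D_H_def intro!: tendsto_in_prob_add tendsto_in_prob_diff ent\<close>)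
  have lim_T: "tendsto_in_prob M
      (\<lambda>m \<omega>. 1 / real m * gen_likelihood_ratio b (all_dists n A) (K_T n A j) m (\<lambda>k. S m k \<omega>)) (D_T j (pmf p))"
    if "j \<in> {2..n - 1}" for j
    by (rule tendsto_in_prob_likelihood_ratio[OF b_gt_1 S gap_T])
      (use that in \<open>auto simp only: D_T_def intro!: tendsto_in_prob_add tendsto_in_prob_diff ent\<close>)
  have \<Omega>: "O_information n X = (\<Sum>j=2..n - 1. D_H j (pmf p) - D_T j (pmf p))"
    unfolding D_H_def D_T_def O_information_eq_ent[OF assms(1,4,5)] by (rule ent_telescope[OF assms(2)])
  \<comment> \<open>All infima are finite, so the differences and the sum in the extended reals are
    those of real numbers.\<close>
  have "(\<Sum>j=2..n - 1. (INF q\<in>K_H n A j. divergence b p q) - (INF q\<in>K_T n A j. divergence b p q)) =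
      (\<Sum>j=2..n - 1. ereal (D_H j (pmf p) - D_T j (pmf p)))"
    using INF_divergence[OF b_gt_1 assms(4) gap_H[OF assms(4)]]
      INF_divergence[OF b_gt_1 assms(4) gap_T[OF assms(4)]]
    by (intro sum.cong refl) simp
  also have "\<dots> = ereal (O_information n X)"
    by (simp add: \<Omega>)
  finally show ?thesis
    using lim_H lim_T \<Omega> by (intro exI[of _ "\<lambda>j. D_H j (pmf p)"] exI[of _ "\<lambda>j. D_T j (pmf p)"]) auto
qed

end
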